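(* Let $P$ be a projection algebra, let $S$ be any projection-generated regular $*$-semigroup with $P=\mathsf P(S)$, and let $p_0\in P$ be arbitrary. Let $D$ be the $\mathscr D$-class of $S$ containing $p_0$, let $P_D=P\cap D$, and let $T$ be any $p_0$-rooted directed spanning tree for the digraph $\mathscr F_D$. Then the maximal subgroup of $\mathsf{PG}(P)$ containing $x_{p_0}$ is defined by the group presentation with generators $\{a_{p,q} : (p,q)\in\mathscr F_D\}$ and relations \begin{align*} &a_{p,q}=1 && \text{for every edge } (p,q) \text{ of } T,\\ &a_{p,p}=1 && \text{for all } p\in P_D,\\ &a_{p,q}=a_{q,p}^{-1} && \text{for all } (p,q)\in\mathscr F_D,\\ &a_{s,v}^{-1}a_{s,w}=a_{u,v}^{-1}a_{u,w} && \text{for all linked diamonds } (s,u;v,w) \text{ in } P_D. \end{align*}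
   Context: A regular $*$-semigroup is a semigroup $S$ with a unary operation $a\mapsto a^*$ satisfying $(a^* )^*=a=aa^*a$ and $(ab)^*=b^*a^*$. A projection is an element $p$ with $p^2=p=p^*$; $\mathsf P(S)$ is the set of projections, and for $p,q\in \mathsf P(S)$ one has $pqp\in \mathsf P(S)$. The set $P=\mathsf P(S)$ with the unary operations $q\mapsto pqp$ ($p\in P$) is the projection algebra of $S$; every (abstract) projection algebra is of this form. $S$ is projection-generated if it is generated as a semigroup by $\mathsf P(S)$. $\mathsf{PG}(P)$ is the semigroup defined by the semigroup presentation with generators $x_p$ ($p\in P$) and relations $x_p^2=x_p$, $(x_px_q)^2=x_px_q$, $x_px_qx_p=x_{pqp}$ ($p,q\in P$). The maximal subgroup containing the idempotent $x_{p_0}$ is its $\mathscr H$-class in $\mathsf{PG}(P)$. The friendliness relation is $\mathscr F=\{(p,q)\in P\times P: pqp=p,\ qpq=q\}$, and $\mathscr F_D=\mathscr F\cap(P_D\times P_D)$, regarded as a symmetric digraph with vertex set $P_D$ (it is strongly connected). A $p_0$-rooted directed spanning tree of $\mathscr F_D$ is a subgraph on all of $P_D$ whose underlying undirected graph is a tree and in which there is a (unique) directed path from $p_0$ to every other vertex. A quadruple $(s,u;v,w)$ of elements of $P_D$ is a linked diamond if $(s,v),(s,w),(u,v),(u,w)\in\mathscr F_D$ and there exists $p\in P$ such that $psp=v$ and $pup=w$. *)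

theory Defs
  imports "HOL-Algebra.Group" "Graph_Theory.Digraph_Component"
begin

section \<open>Semigroups and Green's relations\<close>

text \<open>HOL-Algebra has no record for semigroups; its \<open>monoid\<close> record would force a unit.\<close>

record 'a sgp = "'a partial_object" +
  sgp_mult :: "'a \<Rightarrow> 'a \<Rightarrow> 'a"  (infixl \<open>\<odot>\<index>\<close> 70)

definition right_ideal :: "('a, 'm) sgp_scheme \<Rightarrow> 'a \<Rightarrow> 'a set" where
  "right_ideal S a = insert a {a \<odot>\<^bsub>S\<^esub> x | x. x \<in> carrier S}"

definition left_ideal :: "('a, 'm) sgp_scheme \<Rightarrow> 'a \<Rightarrow> 'a set" where
  "left_ideal S a = insert a {x \<odot>\<^bsub>S\<^esub> a | x. x \<in> carrier S}"

definition green_R :: "('a, 'm) sgp_scheme \<Rightarrow> 'a rel" where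
  "green_R S = {(a, b). a \<in> carrier S \<and> b \<in> carrier S \<and> right_ideal S a = right_ideal S b}"

definition green_L :: "('a, 'm) sgp_scheme \<Rightarrow> 'a rel" where
  "green_L S = {(a, b). a \<in> carrier S \<and> b \<in> carrier S \<and> left_ideal S a = left_ideal S b}"

definition green_H :: "('a, 'm) sgp_scheme \<Rightarrow> 'a rel" where
  "green_H S = green_L S \<inter> green_R S"

text \<open>The join of two equivalence relations is the transitive closure of their union.\<close>

definition green_D :: "('a, 'm) sgp_scheme \<Rightarrow> 'a rel" where
  "green_D S = (green_L S \<union> green_R S)\<^sup>+"

text \<open>Intended for an idempotent \<open>e\<close>, whose \<open>\<H>\<close>-class is the maximal subgroup containing it.\<close>

definition maximal_subgroup :: "('a, 'm) sgp_scheme \<Rightarrow> 'a \<Rightarrow> 'a monoid" where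
  "maximal_subgroup S e = \<lparr>carrier = green_H S `` {e}, monoid.mult = sgp_mult S, one = e\<rparr>"

inductive_set sgp_generate :: "('a, 'm) sgp_scheme \<Rightarrow> 'a set \<Rightarrow> 'a set"
  for S :: "('a, 'm) sgp_scheme" and A :: "'a set" where
  incl: "a \<in> A \<Longrightarrow> a \<in> sgp_generate S A"
| mult: "a \<in> sgp_generate S A \<Longrightarrow> b \<in> sgp_generate S A \<Longrightarrow> a \<odot>\<^bsub>S\<^esub> b \<in> sgp_generate S A"

section \<open>Regular \<open>*\<close>-semigroups and their projection algebras\<close>

record 'a star_sgp = "'a sgp" +
  star :: "'a \<Rightarrow> 'a"

locale regular_star_semigroup =
  fixes S :: "('a, 'm) star_sgp_scheme" (structure)
  assumes mult_closed: "a \<in> carrier S \<Longrightarrow> b \<in> carrier S \<Longrightarrow> a \<odot> b \<in> carrier S"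
    and mult_assoc: "a \<in> carrier S \<Longrightarrow> b \<in> carrier S \<Longrightarrow> c \<in> carrier S
      \<Longrightarrow> (a \<odot> b) \<odot> c = a \<odot> (b \<odot> c)"
    and star_closed: "a \<in> carrier S \<Longrightarrow> star S a \<in> carrier S"
    and star_star: "a \<in> carrier S \<Longrightarrow> star S (star S a) = a"
    and star_regular: "a \<in> carrier S \<Longrightarrow> a \<odot> star S a \<odot> a = a"
    and star_mult: "a \<in> carrier S \<Longrightarrow> b \<in> carrier S \<Longrightarrow> star S (a \<odot> b) = star S b \<odot> star S a"

definition projections :: "('a, 'm) star_sgp_scheme \<Rightarrow> 'a set" where
  "projections S = {p \<in> carrier S. p \<odot>\<^bsub>S\<^esub> p = p \<and> star S p = p}"

definition projection_generated :: "('a, 'm) star_sgp_scheme \<Rightarrow> bool" where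
  "projection_generated S \<longleftrightarrow> sgp_generate S (projections S) = carrier S"

text \<open>A family of unary operations on the carrier, indexed by the carrier: \<open>act P p\<close> is the
  operation attached to \<open>p\<close>, written \<open>q \<mapsto> pqp\<close>.\<close>

record 'a proj_alg = "'a partial_object" +
  act :: "'a \<Rightarrow> 'a \<Rightarrow> 'a"

definition is_projection_algebra_of :: "('a, 'n) proj_alg_scheme \<Rightarrow> ('a, 'm) star_sgp_scheme \<Rightarrow> bool" where
  "is_projection_algebra_of P S \<longleftrightarrow> carrier P = projections S \<and>
     (\<forall>p\<in>carrier P. \<forall>q\<in>carrier P. act P p q = p \<odot>\<^bsub>S\<^esub> q \<odot>\<^bsub>S\<^esub> p)"

section \<open>Semigroup and group presentations\<close>

text \<open>The congruence generated by \<open>R\<close> on a set \<open>W\<close> of words closed under concatenation. Below,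
  \<open>W\<close> is a free semigroup (nonempty words) or a free monoid (all words).\<close>

inductive_set word_cong :: "'x list set \<Rightarrow> 'x list rel \<Rightarrow> 'x list rel"
  for W :: "'x list set" and R :: "'x list rel" where
  base: "(u, v) \<in> R \<Longrightarrow> u \<in> W \<Longrightarrow> v \<in> W \<Longrightarrow> (u, v) \<in> word_cong W R"
| refl: "u \<in> W \<Longrightarrow> (u, u) \<in> word_cong W R"
| sym: "(u, v) \<in> word_cong W R \<Longrightarrow> (v, u) \<in> word_cong W R"
| trans: "(u, v) \<in> word_cong W R \<Longrightarrow> (v, w) \<in> word_cong W R \<Longrightarrow> (u, w) \<in> word_cong W R"
| left: "(u, v) \<in> word_cong W R \<Longrightarrow> w \<in> W \<Longrightarrow> (w @ u, w @ v) \<in> word_cong W R"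
| right: "(u, v) \<in> word_cong W R \<Longrightarrow> w \<in> W \<Longrightarrow> (u @ w, v @ w) \<in> word_cong W R"

text \<open>For a congruence \<open>c\<close> the union below is a single class, that of \<open>u @ v\<close> for any
  representatives \<open>u\<close>, \<open>v\<close>.\<close>

definition class_mult :: "'x list rel \<Rightarrow> 'x list set \<Rightarrow> 'x list set \<Rightarrow> 'x list set" where
  "class_mult c A B = (\<Union>u\<in>A. \<Union>v\<in>B. c `` {u @ v})"

definition semigroup_words :: "'x set \<Rightarrow> 'x list set" where
  "semigroup_words X = lists X - {[]}"

definition semigroup_presentation :: "'x set \<Rightarrow> 'x list rel \<Rightarrow> 'x list set sgp" where
  "semigroup_presentation X R =
     (let c = word_cong (semigroup_words X) R
      in \<lparr>carrier = semigroup_words X // c, sgp_mult = class_mult c\<rparr>)"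

text \<open>The group given by generators \<open>A\<close> and relations \<open>R\<close> is realised as the monoid generated by
  formal symbols \<open>a\<close> and \<open>a\<inverse>\<close> subject to \<open>R\<close> and free cancellation.\<close>

datatype 'g letter = Pos 'g | Neg 'g

definition group_words :: "'g set \<Rightarrow> 'g letter list set" where
  "group_words A = lists (Pos ` A \<union> Neg ` A)"

definition cancellations :: "'g set \<Rightarrow> 'g letter list rel" where
  "cancellations A = {([Pos a, Neg a], []) | a. a \<in> A} \<union> {([Neg a, Pos a], []) | a. a \<in> A}"

definition group_presentation :: "'g set \<Rightarrow> 'g letter list rel \<Rightarrow> 'g letter list set monoid" where
  "group_presentation A R =
     (let c = word_cong (group_words A) (cancellations A \<union> R)
      in \<lparr>carrier = group_words A // c, monoid.mult = class_mult c, one = c `` {[]}\<rparr>)"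

section \<open>The semigroup \<open>PG(P)\<close>\<close>

definition PG_relations :: "('a, 'n) proj_alg_scheme \<Rightarrow> 'a list rel" where
  "PG_relations P =
     {([p, p], [p]) | p. p \<in> carrier P} \<union>
     {([p, q, p, q], [p, q]) | p q. p \<in> carrier P \<and> q \<in> carrier P} \<union>
     {([p, q, p], [act P p q]) | p q. p \<in> carrier P \<and> q \<in> carrier P}"

definition PG :: "('a, 'n) proj_alg_scheme \<Rightarrow> 'a list set sgp" where
  "PG P = semigroup_presentation (carrier P) (PG_relations P)"

definition PG_gen :: "('a, 'n) proj_alg_scheme \<Rightarrow> 'a \<Rightarrow> 'a list set" where
  "PG_gen P p = word_cong (semigroup_words (carrier P)) (PG_relations P) `` {[p]}"

section \<open>Friendliness, linked diamonds and spanning trees\<close>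

definition friendliness :: "('a, 'n) proj_alg_scheme \<Rightarrow> 'a rel" where
  "friendliness P = {(p, q). p \<in> carrier P \<and> q \<in> carrier P \<and> act P p q = p \<and> act P q p = q}"

definition friendliness_digraph :: "('a, 'n) proj_alg_scheme \<Rightarrow> 'a set \<Rightarrow> 'a pair_pre_digraph" where
  "friendliness_digraph P Q = \<lparr>pverts = Q, parcs = friendliness P \<inter> (Q \<times> Q)\<rparr>"

definition linked_diamond ::
    "('a, 'n) proj_alg_scheme \<Rightarrow> 'a set \<Rightarrow> 'a \<Rightarrow> 'a \<Rightarrow> 'a \<Rightarrow> 'a \<Rightarrow> bool" where
  "linked_diamond P Q s u v w \<longleftrightarrow>
     {(s, v), (s, w), (u, v), (u, w)} \<subseteq> friendliness P \<inter> (Q \<times> Q) \<and>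
     (\<exists>p\<in>carrier P. act P p s = v \<and> act P p u = w)"

text \<open>The constant \<open>tree\<close> of \<open>Graph_Theory\<close> only excludes directed cycles, so it does not say
  that the underlying undirected graph is a tree. Here undirected cycles are excluded: those of
  length at most 2 (loops, and a pair of opposite arcs) by \<open>asym\<close>, the others as cycles of
  \<open>mk_symmetric T\<close>, in which every undirected edge \<open>u - v\<close> shows up as a harmless 2-cycle
  \<open>u \<rightarrow> v \<rightarrow> u\<close>.\<close>

definition underlying_tree :: "'a pair_pre_digraph \<Rightarrow> bool" where
  "underlying_tree T \<longleftrightarrow> connected (with_proj T) \<and> asym (parcs T) \<and>
     (\<forall>c. pre_digraph.cycle (with_proj (mk_symmetric (with_proj T))) c \<longrightarrow> length c \<le> 2)"

definition rooted_spanning_tree :: "'a \<Rightarrow> 'a pair_pre_digraph \<Rightarrow> 'a pair_pre_digraph \<Rightarrow> bool" where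
  "rooted_spanning_tree r T G \<longleftrightarrow> spanning (with_proj T) (with_proj G) \<and> underlying_tree T \<and>
     r \<in> pverts T \<and> (\<forall>v\<in>pverts T. \<exists>!w. pre_digraph.apath (with_proj T) r w v)"

section \<open>The presentation of the maximal subgroup\<close>

definition subgroup_generators :: "('a, 'n) proj_alg_scheme \<Rightarrow> 'a set \<Rightarrow> ('a \<times> 'a) set" where
  "subgroup_generators P Q = friendliness P \<inter> (Q \<times> Q)"

definition subgroup_relations ::
    "('a, 'n) proj_alg_scheme \<Rightarrow> 'a set \<Rightarrow> 'a pair_pre_digraph \<Rightarrow> ('a \<times> 'a) letter list rel" where
  "subgroup_relations P Q T =
     {([Pos (p, q)], []) | p q. (p, q) \<in> parcs T} \<union>
     {([Pos (p, p)], []) | p. p \<in> Q} \<union>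
     {([Pos (p, q)], [Neg (q, p)]) | p q. (p, q) \<in> friendliness P \<inter> (Q \<times> Q)} \<union>
     {([Neg (s, v), Pos (s, w)], [Neg (u, v), Pos (u, w)]) | s u v w. linked_diamond P Q s u v w}"

end

theory Submission
  imports Defs
begin

text \<open>Let \<open>G\<close> be the presented group. A projection \<open>p\<close> acts partially on \<open>P_D \<times> G\<close> by
  \<open>(s, g) \<mapsto> (psp, g a\<^bsub>s,psp\<^esub>)\<close>, defined when \<open>sps = s\<close>. The relation \<open>x\<^sub>px\<^sub>qx\<^sub>p = x\<^bsub>pqp\<^esub>\<close> is respected because
  the states \<open>s, psp, q(psp)q, (pqp)s(pqp)\<close> visited by \<open>p, q, p\<close> form a linked diamond, and
  \<open>(x\<^sub>px\<^sub>q)\<^sup>2 = x\<^sub>px\<^sub>q\<close> because \<open>q, p, q\<close> goes back along the edge just traversed. So \<open>PG(P)\<close> acts, and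
  following the state \<open>(p\<^sub>0, 1)\<close> gives a homomorphism from the maximal subgroup to \<open>G\<close>. Its inverse
  sends \<open>a\<^bsub>p,q\<^esub>\<close> to the product of the projections along the tree path from \<open>p\<^sub>0\<close> to \<open>p\<close>, the edge to \<open>q\<close>,
  and the tree path from \<open>q\<close> back to \<open>p\<^sub>0\<close>.\<close>

section \<open>Congruences on words\<close>

declare word_cong.trans [trans]

lemma word_cong_closed:
  assumes "(u, v) \<in> word_cong W R" and "\<And>x y. x \<in> W \<Longrightarrow> y \<in> W \<Longrightarrow> x @ y \<in> W"
  shows "u \<in> W" and "v \<in> W"
  using assms(1) by (induction rule: word_cong.induct) (auto intro: assms(2))

lemma equiv_word_cong:
  assumes "\<And>x y. x \<in> W \<Longrightarrow> y \<in> W \<Longrightarrow> x @ y \<in> W"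
  shows "equiv W (word_cong W R)"
proof (rule equivI)
  show "word_cong W R \<subseteq> W \<times> W"
    using word_cong_closed[OF _ assms] by auto
qed (auto intro!: refl_onI symI transI intro: word_cong.intros)

lemma word_cong_append:
  assumes "(u, u') \<in> word_cong W R" and "(v, v') \<in> word_cong W R"
    and "\<And>x y. x \<in> W \<Longrightarrow> y \<in> W \<Longrightarrow> x @ y \<in> W"
  shows "(u @ v, u' @ v') \<in> word_cong W R"
  using word_cong.right[OF assms(1), of v] word_cong.left[OF assms(2), of u']
    word_cong_closed[OF assms(1,3)] word_cong_closed[OF assms(2,3)]
  by (blast intro: word_cong.trans)

text \<open>All terms of the union that defines \<open>class_mult\<close> coincide, since the
  congruence is compatible with concatenation; reflexivity makes the union nonempty.\<close>

lemma class_mult_word_cong: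
  assumes "u \<in> W" and "v \<in> W" and W: "\<And>x y. x \<in> W \<Longrightarrow> y \<in> W \<Longrightarrow> x @ y \<in> W"
  shows "class_mult (word_cong W R) (word_cong W R `` {u}) (word_cong W R `` {v})
    = word_cong W R `` {u @ v}"
proof -
  have "word_cong W R `` {u' @ v'} = word_cong W R `` {u @ v}"
    if "(u, u') \<in> word_cong W R" "(v, v') \<in> word_cong W R" for u' v'
    using equiv_class_eq[OF equiv_word_cong[OF W] word_cong_append[OF that W]] by simp
  moreover have "(u, u) \<in> word_cong W R" "(v, v) \<in> word_cong W R"
    using assms by (auto intro: word_cong.refl)
  ultimately show ?thesis
    unfolding class_mult_def by blast
qed

lemma semigroup_words_append:
  "u \<in> semigroup_words X \<Longrightarrow> v \<in> semigroup_words X \<Longrightarrow> u @ v \<in> semigroup_words X"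
  by (auto simp: semigroup_words_def)

lemma group_words_append:
  "u \<in> group_words A \<Longrightarrow> v \<in> group_words A \<Longrightarrow> u @ v \<in> group_words A"
  by (auto simp: group_words_def)

lemma group_words_simps [simp]:
  "[] \<in> group_words A"
  "Pos a # w \<in> group_words A \<longleftrightarrow> a \<in> A \<and> w \<in> group_words A"
  "Neg a # w \<in> group_words A \<longleftrightarrow> a \<in> A \<and> w \<in> group_words A"
  "u @ w \<in> group_words A \<longleftrightarrow> u \<in> group_words A \<and> w \<in> group_words A"
  by (auto simp: group_words_def)

section \<open>Formal inverses of group words\<close>

fun flip :: "'g letter \<Rightarrow> 'g letter" where
  "flip (Pos a) = Neg a"
| "flip (Neg a) = Pos a"

definition word_inverse :: "'g letter list \<Rightarrow> 'g letter list" where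
  "word_inverse w = rev (map flip w)"

lemma word_inverse_closed: "w \<in> group_words A \<Longrightarrow> word_inverse w \<in> group_words A"
proof -
  have "flip x \<in> Pos ` A \<union> Neg ` A" if "x \<in> Pos ` A \<union> Neg ` A" for x
    using that by auto
  then show "w \<in> group_words A \<Longrightarrow> word_inverse w \<in> group_words A"
    unfolding word_inverse_def group_words_def by (auto simp: in_lists_conv_set)
qed

lemma word_inverse_inverse: "word_inverse (word_inverse w) = w"
proof -
  have "flip (flip x) = x" for x :: "'a letter" by (cases x) auto
  then show ?thesis by (simp add: word_inverse_def rev_map comp_def)
qed

lemma word_inverse_right:
  assumes "w \<in> group_words A"
  shows "(w @ word_inverse w, []) \<in> word_cong (group_words A) (cancellations A \<union> R)"
  using assms
proof (induction w)
  case Nil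
  then show ?case by (auto simp: word_inverse_def intro: word_cong.refl)
next
  case (Cons x w)
  let ?c = "word_cong (group_words A) (cancellations A \<union> R)"
  have x: "[x] \<in> group_words A" "[flip x] \<in> group_words A" and w: "w \<in> group_words A"
    using Cons.prems by (cases x; simp)+
  have "([x] @ (w @ word_inverse w) @ [flip x], [x] @ [] @ [flip x]) \<in> ?c"
    using Cons.IH[OF w] x by (intro word_cong_append) (auto intro: word_cong.refl)
  moreover have "([x] @ [] @ [flip x], []) \<in> ?c"
    using x by (cases x) (auto intro!: word_cong.base simp: cancellations_def)
  ultimately show ?case
    by (auto simp: word_inverse_def intro: word_cong.trans)
qed

lemma word_inverse_left:
  assumes "w \<in> group_words A"
  shows "(word_inverse w @ w, []) \<in> word_cong (group_words A) (cancellations A \<union> R)"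
  using word_inverse_right[OF word_inverse_closed[OF assms]] by (simp add: word_inverse_inverse)

section \<open>Projection algebras\<close>

text \<open>Identities of the maps q \<mapsto> pqp: \<open>swap\<close> and \<open>idem2\<close>
  express pqpq = pq for projections, and \<open>conj\<close> expands conjugation by pqp into three
  successive conjugations.\<close>

locale projection_algebra =
  fixes P :: "('a, 'n) proj_alg_scheme"
  assumes closed: "p \<in> carrier P \<Longrightarrow> q \<in> carrier P \<Longrightarrow> act P p q \<in> carrier P"
    and self: "p \<in> carrier P \<Longrightarrow> act P p p = p"
    and idem: "p \<in> carrier P \<Longrightarrow> q \<in> carrier P \<Longrightarrow> act P p (act P p q) = act P p q"
    and swap: "p \<in> carrier P \<Longrightarrow> q \<in> carrier P \<Longrightarrow> act P p (act P q p) = act P p q"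
    and conj: "p \<in> carrier P \<Longrightarrow> q \<in> carrier P \<Longrightarrow> s \<in> carrier P
      \<Longrightarrow> act P (act P p q) s = act P p (act P q (act P p s))"
    and idem2: "p \<in> carrier P \<Longrightarrow> q \<in> carrier P \<Longrightarrow> s \<in> carrier P
      \<Longrightarrow> act P p (act P q (act P p (act P q s))) = act P p (act P q s)"
begin

abbreviation action :: "'a \<Rightarrow> 'a \<Rightarrow> 'a" (infixr \<open>\<triangleright>\<close> 75) where
  "p \<triangleright> q \<equiv> act P p q"

lemma friendly_iff:
  "(p, q) \<in> friendliness P \<longleftrightarrow> p \<in> carrier P \<and> q \<in> carrier P \<and> p \<triangleright> q = p \<and> q \<triangleright> p = q"
  by (simp add: friendliness_def)

lemma friendly_refl: "p \<in> carrier P \<Longrightarrow> (p, p) \<in> friendliness P"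
  by (simp add: friendly_iff self)

lemma friendly_sym: "(p, q) \<in> friendliness P \<Longrightarrow> (q, p) \<in> friendliness P"
  by (simp add: friendly_iff)

text \<open>By \<open>swap\<close>, s(psp)s = sps = s, and conjugating s by psp simplifies to psp.
  Hence every defined step of the action runs along a friendliness edge.\<close>

lemma friendly_step:
  assumes "s \<in> carrier P" "p \<in> carrier P" "s \<triangleright> p = s"
  shows "(s, p \<triangleright> s) \<in> friendliness P"
  using assms by (simp add: friendly_iff closed swap conj self)

text \<open>Conjugation by \<open>p\<close> followed by conjugation by \<open>s\<close> is an
  idempotent map, by \<open>idem2\<close>. As it sends \<open>q\<close> to \<open>s\<close>, it
  fixes \<open>s\<close>, and \<open>swap\<close> shortens this to the claim.\<close>

lemma absorb_left:
  assumes "s \<in> carrier P" "p \<in> carrier P" "q \<in> carrier P" "s \<triangleright> p \<triangleright> q = s"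
  shows "s \<triangleright> p = s"
proof -
  have "s \<triangleright> p \<triangleright> s \<triangleright> p \<triangleright> q = s \<triangleright> p \<triangleright> q"
    by (rule idem2[OF assms(1-3)])
  then have "s \<triangleright> p \<triangleright> s = s"
    by (simp only: assms(4))
  then show ?thesis
    by (simp only: swap[OF assms(1,2)])
qed

text \<open>This compares domains: on the left pqp acts at \<open>s\<close>, on the right
  \<open>p\<close> and then \<open>q\<close> act in succession. The identity \<open>conj\<close>
  converts each condition into the other.\<close>

lemma absorb_iff:
  assumes c: "s \<in> carrier P" "p \<in> carrier P" "q \<in> carrier P"
  shows "s \<triangleright> p \<triangleright> q = s \<longleftrightarrow> s \<triangleright> p = s \<and> (p \<triangleright> s) \<triangleright> q = p \<triangleright> s"
proof (intro iffI conjI)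
  assume *: "s \<triangleright> p \<triangleright> q = s"
  show "s \<triangleright> p = s"
    by (rule absorb_left[OF c *])
  show "(p \<triangleright> s) \<triangleright> q = p \<triangleright> s"
    by (simp only: conj[OF c(2,1,3)] *)
next
  assume *: "s \<triangleright> p = s \<and> (p \<triangleright> s) \<triangleright> q = p \<triangleright> s"
  have "s \<triangleright> p \<triangleright> q = (s \<triangleright> p) \<triangleright> p \<triangleright> q"
    using * by simp
  also have "\<dots> = s \<triangleright> p \<triangleright> s \<triangleright> p \<triangleright> q"
    by (rule conj[OF c(1,2) closed[OF c(2,3)]])
  also have "p \<triangleright> s \<triangleright> p \<triangleright> q = p \<triangleright> s"
    using * conj[OF c(2,1,3)] by simp
  also have "s \<triangleright> p \<triangleright> s = s"
    using * swap[OF c(1,2)] by simp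
  finally show "s \<triangleright> p \<triangleright> q = s" .
qed

text \<open>After \<open>p\<close> and \<open>q\<close> have acted, \<open>p\<close> can always act
  again: \<open>conj\<close> and \<open>swap\<close> expand the left side until it contains
  \<open>s \<triangleright> p \<triangleright> q\<close>, which is \<open>s\<close> by
  \<open>absorb_iff\<close>.\<close>

lemma absorb_back:
  assumes "s \<in> carrier P" "p \<in> carrier P" "q \<in> carrier P"
    and "s \<triangleright> p = s" "(p \<triangleright> s) \<triangleright> q = p \<triangleright> s"
  shows "(q \<triangleright> p \<triangleright> s) \<triangleright> p = q \<triangleright> p \<triangleright> s"
proof -
  have *: "s \<triangleright> p \<triangleright> q = s"
    using assms absorb_iff by blast
  have "(q \<triangleright> p \<triangleright> s) \<triangleright> p = q \<triangleright> p \<triangleright> s \<triangleright> p \<triangleright> q"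
    using assms(1-3) by (simp add: conj closed swap)
  then show ?thesis
    by (simp only: *)
qed

section \<open>Word calculus in PG(P)\<close>

abbreviation PG_cong :: "'a list \<Rightarrow> 'a list \<Rightarrow> bool" (infix \<open>\<approx>\<close> 50) where
  "u \<approx> v \<equiv> (u, v) \<in> word_cong (semigroup_words (carrier P)) (PG_relations P)"

lemma PG_refl: "set u \<subseteq> carrier P \<Longrightarrow> u \<noteq> [] \<Longrightarrow> u \<approx> u"
  by (rule word_cong.refl) (auto simp: semigroup_words_def)

lemma PG_closed:
  assumes "u \<approx> v"
  shows "set u \<subseteq> carrier P" "u \<noteq> []" "set v \<subseteq> carrier P" "v \<noteq> []"
  using word_cong_closed[OF assms semigroup_words_append] by (auto simp: semigroup_words_def)

lemma PG_context:
  assumes "u \<approx> v" "set a \<subseteq> carrier P" "set b \<subseteq> carrier P"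
  shows "a @ u @ b \<approx> a @ v @ b"
proof -
  have *: "u @ b \<approx> v @ b"
    using assms by (cases "b = []") (auto intro!: word_cong.right simp: semigroup_words_def)
  then show ?thesis
    using assms by (cases "a = []") (auto intro!: word_cong.left simp: semigroup_words_def)
qed

lemma PG_append: "u \<approx> u' \<Longrightarrow> v \<approx> v' \<Longrightarrow> u @ v \<approx> u' @ v'"
  by (rule word_cong_append) (auto intro: semigroup_words_append)

lemma PG_idem: "p \<in> carrier P \<Longrightarrow> [p, p] \<approx> [p]"
  by (rule word_cong.base) (auto simp: PG_relations_def semigroup_words_def)

lemma PG_conj: "p \<in> carrier P \<Longrightarrow> q \<in> carrier P \<Longrightarrow> [p, q, p] \<approx> [p \<triangleright> q]"
  using closed
  by (intro word_cong.base) (auto simp: PG_relations_def semigroup_words_def)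

lemma PG_friendly: "(p, q) \<in> friendliness P \<Longrightarrow> [p, q, p] \<approx> [p]"
  using PG_conj[of p q] by (simp add: friendly_iff)

text \<open>Doubling sp to spsp and contracting psp replaces a letter by the state to which it leads
  from \<open>s\<close>.\<close>

lemma PG_step:
  assumes "s \<in> carrier P" "p \<in> carrier P"
  shows "[s, p] \<approx> [s, p \<triangleright> s]"
proof -
  have "[s, p] \<approx> [s, p, s, p]"
    using assms
    by (intro word_cong.sym[OF word_cong.base]) (auto simp: PG_relations_def semigroup_words_def)
  also have "[s, p, s, p] \<approx> [s, p \<triangleright> s]"
    using PG_context[OF PG_conj, of p s "[s]" "[]"] assms by simp
  finally show ?thesis .
qed

lemma PG_step':
  assumes "s \<in> carrier P" "p \<in> carrier P"
  shows "[p, s] \<approx> [p \<triangleright> s, s]"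
proof -
  have "[p, s] \<approx> [p, s, p, s]"
    using assms
    by (intro word_cong.sym[OF word_cong.base]) (auto simp: PG_relations_def semigroup_words_def)
  also have "[p, s, p, s] \<approx> [p \<triangleright> s, s]"
    using PG_context[OF PG_conj, of p s "[]" "[s]"] assms by simp
  finally show ?thesis .
qed

text \<open>Both words equal \<open>[p, s, p, u, p]\<close> for the linking projection
  \<open>p\<close>: on one side \<open>w\<close> is unfolded as pup, on the other \<open>v\<close>
  is folded from psp.\<close>

lemma PG_diamond:
  assumes "linked_diamond P Q s u v w"
  shows "[v, s, w] \<approx> [v, u, w]"
proof -
  obtain p where p: "p \<in> carrier P" "p \<triangleright> s = v" "p \<triangleright> u = w"
    using assms by (auto simp: linked_diamond_def)
  have c: "s \<in> carrier P" "u \<in> carrier P" "v \<in> carrier P" "w \<in> carrier P"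
    using assms by (auto simp: linked_diamond_def friendly_iff)
  have "[v, s, w] \<approx> [p, s, w]"
    using PG_context[OF PG_step'[of s p], of "[]" "[w]"] p c by (simp add: word_cong.sym)
  also have "[p, s, w] \<approx> [p, s, p, u, p]"
    using PG_context[OF PG_conj[of p u], of "[p, s]" "[]"] p c by (simp add: word_cong.sym)
  also have "[p, s, p, u, p] \<approx> [v, u, p]"
    using PG_context[OF PG_conj[of p s], of "[]" "[u, p]"] p c by simp
  also have "[v, u, p] \<approx> [v, u, w]"
    using PG_context[OF PG_step[of u p], of "[v]" "[]"] p c by simp
  finally show ?thesis .
qed

lemma PG_absorb_last:
  assumes "set u \<subseteq> carrier P" "u \<noteq> []"
  shows "u @ [last u] \<approx> u"
  using PG_context[OF PG_idem[of "last u"], of "butlast u" "[]"] assms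
  by (metis append.right_neutral append_Cons append_Nil append_assoc append_butlast_last_id
      empty_set empty_subsetI in_set_butlastD last_in_set subset_code(1))

lemma PG_absorb_hd:
  assumes "set u \<subseteq> carrier P" "u \<noteq> []"
  shows "hd u # u \<approx> u"
  using PG_context[OF PG_idem[of "hd u"], of "[]" "tl u"] assms by (cases u) auto

text \<open>The word collapses from its middle outwards: once the inner part has shrunk to its first
  letter, friendliness absorbs that letter between the two copies of its predecessor.\<close>

lemma PG_path_rev:
  assumes "successively (\<lambda>x y. (x, y) \<in> friendliness P) u" "u \<noteq> []" "set u \<subseteq> carrier P"
  shows "u @ rev u \<approx> [hd u]"
  using assms
proof (induction u)
  case Nil
  then show ?case by simp
next
  case (Cons x u)
  show ?case
  proof (cases "u = []")
    case True
    then show ?thesis using Cons.prems PG_idem by simp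
  next
    case False
    have "[x] @ (u @ rev u) @ [x] \<approx> [x] @ [hd u] @ [x]"
      using Cons False by (intro PG_context) (auto simp: successively_Cons)
    also have "[x] @ [hd u] @ [x] \<approx> [x]"
      using Cons.prems False PG_friendly by (simp add: successively_Cons)
    finally show ?thesis by simp
  qed
qed

section \<open>Green's relations of PG(P) in terms of words\<close>

abbreviation PG_class :: "'a list \<Rightarrow> 'a list set" where
  "PG_class w \<equiv> word_cong (semigroup_words (carrier P)) (PG_relations P) `` {w}"

text \<open>Every element of PG(P) is the class of a word, so a principal ideal is the image of a
  set of words; comparing ideals thus reduces to \<open>\<approx>\<close>.\<close>

lemma PG_right_ideal:
  assumes "w \<in> semigroup_words (carrier P)"
  shows "right_ideal (PG P) (PG_class w)
    = PG_class ` insert w {w @ x | x. x \<in> semigroup_words (carrier P)}"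
proof -
  let ?c = "word_cong (semigroup_words (carrier P)) (PG_relations P)"
  have "class_mult ?c (?c `` {w}) (?c `` {x}) = ?c `` {w @ x}"
    if "x \<in> semigroup_words (carrier P)" for x
    by (rule class_mult_word_cong[OF assms that semigroup_words_append])
  then have "{class_mult ?c (?c `` {w}) X | X. X \<in> semigroup_words (carrier P) // ?c}
      = (\<lambda>x. ?c `` {w @ x}) ` semigroup_words (carrier P)"
    unfolding quotient_def by (auto; metis)
  then show ?thesis
    by (auto simp: right_ideal_def PG_def semigroup_presentation_def Let_def)
qed

lemma PG_left_ideal:
  assumes "w \<in> semigroup_words (carrier P)"
  shows "left_ideal (PG P) (PG_class w)
    = PG_class ` insert w {x @ w | x. x \<in> semigroup_words (carrier P)}"
proof -
  let ?c = "word_cong (semigroup_words (carrier P)) (PG_relations P)"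
  have "class_mult ?c (?c `` {x}) (?c `` {w}) = ?c `` {x @ w}"
    if "x \<in> semigroup_words (carrier P)" for x
    by (rule class_mult_word_cong[OF that assms semigroup_words_append])
  then have "{class_mult ?c X (?c `` {w}) | X. X \<in> semigroup_words (carrier P) // ?c}
      = (\<lambda>x. ?c `` {x @ w}) ` semigroup_words (carrier P)"
    unfolding quotient_def by (auto; metis)
  then show ?thesis
    by (auto simp: left_ideal_def PG_def semigroup_presentation_def Let_def)
qed

lemma PG_class_eq:
  assumes "u \<approx> w"
  shows "PG_class u
    = PG_class w"
  by (rule equiv_class_eq[OF equiv_word_cong assms]) (rule semigroup_words_append)

lemma PG_right_ideal_mono:
  assumes "u \<approx> w @ x" "w \<in> semigroup_words (carrier P)" "x \<in> semigroup_words (carrier P)"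
  shows "right_ideal (PG P) (PG_class u)
    \<subseteq> right_ideal (PG P) (PG_class w)"
proof -
  have u: "u \<in> semigroup_words (carrier P)"
    using PG_closed[OF assms(1)] by (auto simp: semigroup_words_def)
  have step: "u @ y \<approx> w @ (x @ y)" if "y \<in> semigroup_words (carrier P)" for y
    using word_cong.right[OF assms(1) that] by simp
  show ?thesis
    unfolding PG_right_ideal[OF u] PG_right_ideal[OF assms(2)]
  proof (rule image_subsetI)
    fix v assume "v \<in> insert u {u @ y | y. y \<in> semigroup_words (carrier P)}"
    then consider "v = u" | y where "v = u @ y" "y \<in> semigroup_words (carrier P)"
      by blast
    then obtain z where "v \<approx> w @ z" "z \<in> semigroup_words (carrier P)"
    proof cases
      case 1
      then show thesis using that[of x] assms by simp
    next
      case (2 y)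
      then show thesis
        using that[OF _ semigroup_words_append[OF assms(3) 2(2)]] step 2 by simp
    qed
    then show "PG_class v \<in> PG_class ` insert w {w @ x | x. x \<in> semigroup_words (carrier P)}"
      using PG_class_eq[of v "w @ z"] by (intro image_eqI[of _ _ "w @ z"]) auto
  qed
qed

lemma PG_left_ideal_mono:
  assumes "u \<approx> x @ w" "w \<in> semigroup_words (carrier P)" "x \<in> semigroup_words (carrier P)"
  shows "left_ideal (PG P) (PG_class u)
    \<subseteq> left_ideal (PG P) (PG_class w)"
proof -
  have u: "u \<in> semigroup_words (carrier P)"
    using PG_closed[OF assms(1)] by (auto simp: semigroup_words_def)
  have step: "y @ u \<approx> (y @ x) @ w" if "y \<in> semigroup_words (carrier P)" for y
    using word_cong.left[OF assms(1) that] by simp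
  show ?thesis
    unfolding PG_left_ideal[OF u] PG_left_ideal[OF assms(2)]
  proof (rule image_subsetI)
    fix v assume "v \<in> insert u {y @ u | y. y \<in> semigroup_words (carrier P)}"
    then consider "v = u" | y where "v = y @ u" "y \<in> semigroup_words (carrier P)"
      by blast
    then obtain z where "v \<approx> z @ w" "z \<in> semigroup_words (carrier P)"
    proof cases
      case 1
      then show thesis using that[of x] assms by simp
    next
      case (2 y)
      then show thesis
        using that[OF _ semigroup_words_append[OF 2(2) assms(3)]] step 2 by simp
    qed
    then show "PG_class v \<in> PG_class ` insert w {x @ w | x. x \<in> semigroup_words (carrier P)}"
      using PG_class_eq[of v "z @ w"] by (intro image_eqI[of _ _ "z @ w"]) auto
  qed
qed

lemma PG_class_eq_iff:
  "u \<in> semigroup_words (carrier P) \<Longrightarrow> w \<in> semigroup_words (carrier P)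
    \<Longrightarrow> PG_class u = PG_class w \<longleftrightarrow> u \<approx> w"
  by (rule eq_equiv_class_iff[OF equiv_word_cong]) (rule semigroup_words_append)

lemma PG_right_ideal_cases:
  assumes "right_ideal (PG P) (PG_class u) = right_ideal (PG P) (PG_class w)"
    and u: "u \<in> semigroup_words (carrier P)" and w: "w \<in> semigroup_words (carrier P)"
  obtains "u \<approx> w" | x where "u \<approx> w @ x" "x \<in> semigroup_words (carrier P)"
proof -
  have "PG_class u \<in> right_ideal (PG P) (PG_class w)"
    unfolding assms(1)[symmetric] by (simp add: right_ideal_def)
  then obtain v where "PG_class u = PG_class v"
    "v \<in> insert w {w @ x | x. x \<in> semigroup_words (carrier P)}"
    unfolding PG_right_ideal[OF w] by (rule imageE)
  then consider "PG_class u = PG_class w"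
    | x where "PG_class u = PG_class (w @ x)" "x \<in> semigroup_words (carrier P)"
    by blast
  then show thesis
  proof cases
    case 1
    then show thesis using that(1) PG_class_eq_iff[OF u w] by simp
  next
    case (2 x)
    then show thesis using that(2) PG_class_eq_iff[OF u semigroup_words_append[OF w]] by simp
  qed
qed

lemma PG_left_ideal_cases:
  assumes "left_ideal (PG P) (PG_class u) = left_ideal (PG P) (PG_class w)"
    and u: "u \<in> semigroup_words (carrier P)" and w: "w \<in> semigroup_words (carrier P)"
  obtains "u \<approx> w" | x where "u \<approx> x @ w" "x \<in> semigroup_words (carrier P)"
proof -
  have "PG_class u \<in> left_ideal (PG P) (PG_class w)"
    unfolding assms(1)[symmetric] by (simp add: left_ideal_def)
  then obtain v where "PG_class u = PG_class v"
    "v \<in> insert w {x @ w | x. x \<in> semigroup_words (carrier P)}"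
    unfolding PG_left_ideal[OF w] by (rule imageE)
  then consider "PG_class u = PG_class w"
    | x where "PG_class u = PG_class (x @ w)" "x \<in> semigroup_words (carrier P)"
    by blast
  then show thesis
  proof cases
    case 1
    then show thesis using that(1) PG_class_eq_iff[OF u w] by simp
  next
    case (2 x)
    then show thesis using that(2) PG_class_eq_iff[OF u semigroup_words_append[OF _ w]] by simp
  qed
qed

text \<open>For an idempotent \<open>e\<close>, lying in its right (left) ideal means being fixed by
  left (right) multiplication with \<open>e\<close>. The two existential conditions put
  \<open>e\<close> into the ideals generated by \<open>w\<close>.\<close>

lemma PG_green_H_iff:
  assumes e: "e \<in> carrier P" and w: "w \<in> semigroup_words (carrier P)"
  shows "(PG_class [e], PG_class w) \<in> green_H (PG P)
    \<longleftrightarrow> e # w \<approx> w \<and> w @ [e] \<approx> w \<and> (\<exists>x. w @ x \<approx> [e]) \<and> (\<exists>y. y @ w \<approx> [e])"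
    (is "?lhs \<longleftrightarrow> ?rhs")
proof
  have eW: "[e] \<in> semigroup_words (carrier P)" using e by (simp add: semigroup_words_def)
  note ee = PG_idem[OF e] and e_refl = word_cong.refl[OF eW]
  {
    assume ?lhs
    then have R: "right_ideal (PG P) (PG_class [e]) = right_ideal (PG P) (PG_class w)"
      and L: "left_ideal (PG P) (PG_class [e]) = left_ideal (PG P) (PG_class w)"
      by (auto simp: green_H_def green_R_def green_L_def)
    have "[e] @ w \<approx> w"
      using R[symmetric] w eW
    proof (cases rule: PG_right_ideal_cases)
      case 1
      have "[e] @ w \<approx> [e] @ [e]" by (rule PG_append[OF e_refl 1])
      then show ?thesis using ee word_cong.sym[OF 1] by (auto intro: word_cong.trans)
    next
      case (2 x)
      have "[e] @ w \<approx> [e] @ ([e] @ x)" by (rule PG_append[OF e_refl 2(1)])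
      also have "[e] @ ([e] @ x) \<approx> [e] @ x" using word_cong.right[OF ee 2(2)] by simp
      also note word_cong.sym[OF 2(1)]
      finally show ?thesis .
    qed
    moreover have "w @ [e] \<approx> w"
      using L[symmetric] w eW
    proof (cases rule: PG_left_ideal_cases)
      case 1
      have "w @ [e] \<approx> [e] @ [e]" by (rule PG_append[OF 1 e_refl])
      then show ?thesis using ee word_cong.sym[OF 1] by (auto intro: word_cong.trans)
    next
      case (2 x)
      have "w @ [e] \<approx> (x @ [e]) @ [e]" by (rule PG_append[OF 2(1) e_refl])
      also have "(x @ [e]) @ [e] \<approx> x @ [e]" using word_cong.left[OF ee 2(2)] by simp
      also note word_cong.sym[OF 2(1)]
      finally show ?thesis .
    qed
    \<comment> \<open>If the ideals agree because \<open>[e] \<approx> w\<close>, then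
      \<open>w\<close> itself serves as the cofactor on either side.\<close>
    moreover have square: "w @ w \<approx> [e]" if "[e] \<approx> w"
      using PG_append[OF word_cong.sym[OF that] word_cong.sym[OF that]] ee
      by (auto intro: word_cong.trans)
    have "\<exists>x. w @ x \<approx> [e]"
      using R eW w by (cases rule: PG_right_ideal_cases) (use square word_cong.sym in blast)+
    moreover have "\<exists>y. y @ w \<approx> [e]"
      using L eW w by (cases rule: PG_left_ideal_cases) (use square word_cong.sym in blast)+
    ultimately show ?rhs by simp
  }
  assume ?rhs
  then obtain x y where *: "[e] @ w \<approx> w" "w @ [e] \<approx> w" "w @ x \<approx> [e]" "y @ w \<approx> [e]"
    by auto
  \<comment> \<open>The words \<open>x\<close> and \<open>y\<close> may be empty; the extra letter
    \<open>e\<close> turns them into elements of the free semigroup.\<close>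
  have x: "x @ [e] \<in> semigroup_words (carrier P)" and y: "[e] @ y \<in> semigroup_words (carrier P)"
    using PG_closed(1)[OF *(3)] PG_closed(1)[OF *(4)] e by (auto simp: semigroup_words_def)
  have wx: "[e] \<approx> w @ (x @ [e])" and yw: "[e] \<approx> ([e] @ y) @ w"
    using word_cong.right[OF *(3) eW] word_cong.left[OF *(4) eW] ee
    by (auto intro: word_cong.trans word_cong.sym)
  have "right_ideal (PG P) (PG_class [e]) = right_ideal (PG P) (PG_class w)"
    by (intro subset_antisym PG_right_ideal_mono[OF wx w x]
        PG_right_ideal_mono[OF word_cong.sym[OF *(1)] eW w])
  moreover have "left_ideal (PG P) (PG_class [e]) = left_ideal (PG P) (PG_class w)"
    by (intro subset_antisym PG_left_ideal_mono[OF yw w y]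
        PG_left_ideal_mono[OF word_cong.sym[OF *(2)] eW w])
  ultimately show ?lhs
    using w eW
    by (simp add: green_H_def green_R_def green_L_def PG_def semigroup_presentation_def
        Let_def quotientI)
qed

text \<open>The condition \<open>sps = s\<close> says that \<open>sp\<close> is \<open>\<R>\<close>-related to \<open>s\<close>.\<close>

primrec acts :: "'a \<Rightarrow> 'a list \<Rightarrow> bool" where
  "acts s [] \<longleftrightarrow> True"
| "acts s (p # w) \<longleftrightarrow> s \<triangleright> p = s \<and> acts (p \<triangleright> s) w"

text \<open>The fold reads letters from left to right, so words act on the right. The function is
  total, but its value is meaningful only where \<open>acts\<close> holds; the same is true of
  \<open>label\<close>.\<close>

abbreviation target :: "'a \<Rightarrow> 'a list \<Rightarrow> 'a" where
  "target s w \<equiv> fold (\<triangleright>) w s"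

text \<open>The group component accumulated along the run, kept as a word of positive letters rather
  than as a class.\<close>

primrec label :: "'a \<Rightarrow> 'a list \<Rightarrow> ('a \<times> 'a) letter list" where
  "label s [] = []"
| "label s (p # w) = Pos (s, p \<triangleright> s) # label (p \<triangleright> s) w"

lemma acts_append [simp]: "acts s (u @ w) \<longleftrightarrow> acts s u \<and> acts (target s u) w"
  by (induction u arbitrary: s) auto

lemma label_append [simp]: "label s (u @ w) = label s u @ label (target s u) w"
  by (induction u arbitrary: s) auto

end

section \<open>The friendliness component of a projection\<close>

text \<open>From the D-class this keeps the closure under friendliness, and from the tree the vertex
  lists \<open>t p\<close> of the root paths. The condition \<open>path_arc\<close> says that a tree
  arc prolongs the root path of its source.\<close>

locale projection_component = projection_algebra P
  for P :: "('a, 'n) proj_alg_scheme" +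
  fixes Q :: "'a set" and r :: 'a and T :: "'a pair_pre_digraph" and t :: "'a \<Rightarrow> 'a list"
  assumes Q_carrier: "Q \<subseteq> carrier P"
    and Q_closed: "p \<in> Q \<Longrightarrow> (p, q) \<in> friendliness P \<Longrightarrow> q \<in> Q"
    and root: "r \<in> Q" "t r = [r]"
    and arcs: "parcs T \<subseteq> friendliness P \<inter> (Q \<times> Q)"
    and path: "p \<in> Q \<Longrightarrow> set (t p) \<subseteq> Q" "p \<in> Q \<Longrightarrow> t p \<noteq> []"
      "p \<in> Q \<Longrightarrow> hd (t p) = r" "p \<in> Q \<Longrightarrow> last (t p) = p"
      "p \<in> Q \<Longrightarrow> successively (\<lambda>x y. (x, y) \<in> parcs T) (t p)"
    and path_arc: "(p, q) \<in> parcs T \<Longrightarrow> t q = t p @ [q]"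
begin

section \<open>Consequences of the group relations\<close>

abbreviation A :: "('a \<times> 'a) set" where
  "A \<equiv> subgroup_generators P Q"

abbreviation group_cong :: "('a \<times> 'a) letter list \<Rightarrow> ('a \<times> 'a) letter list \<Rightarrow> bool"
    (infix \<open>\<simeq>\<close> 50) where
  "g \<simeq> h \<equiv> (g, h) \<in> word_cong (group_words A) (cancellations A \<union> subgroup_relations P Q T)"

lemma A_iff: "(p, q) \<in> A \<longleftrightarrow> p \<in> Q \<and> q \<in> Q \<and> p \<triangleright> q = p \<and> q \<triangleright> p = q"
  using Q_carrier by (auto simp: subgroup_generators_def friendly_iff)

lemma Q_in: "p \<in> Q \<Longrightarrow> p \<in> carrier P"
  using Q_carrier by auto

lemma arc_A: "(p, q) \<in> parcs T \<Longrightarrow> (p, q) \<in> A"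
  using arcs by (auto simp: subgroup_generators_def)

lemma A_friendly: "(p, q) \<in> A \<Longrightarrow> (p, q) \<in> friendliness P"
  by (auto simp: subgroup_generators_def)

lemma A_refl: "p \<in> Q \<Longrightarrow> (p, p) \<in> A"
  by (simp add: A_iff self Q_in)

lemma A_sym: "(p, q) \<in> A \<Longrightarrow> (q, p) \<in> A"
  by (simp add: A_iff)

lemma A_step: "s \<in> Q \<Longrightarrow> p \<in> carrier P \<Longrightarrow> s \<triangleright> p = s \<Longrightarrow> (s, p \<triangleright> s) \<in> A"
  using friendly_step[of s p] Q_closed Q_in by (auto simp: subgroup_generators_def)

lemma group_refl: "g \<in> group_words A \<Longrightarrow> g \<simeq> g"
  by (rule word_cong.refl)

lemma group_append: "g \<simeq> g' \<Longrightarrow> h \<simeq> h' \<Longrightarrow> g @ h \<simeq> g' @ h'"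
  by (rule word_cong_append) (auto intro: group_words_append)

lemma group_context:
  "g \<simeq> g' \<Longrightarrow> a \<in> group_words A \<Longrightarrow> b \<in> group_words A \<Longrightarrow> a @ g @ b \<simeq> a @ g' @ b"
  by (intro group_append group_refl)

lemma group_closed:
  assumes "g \<simeq> h"
  shows "g \<in> group_words A" "h \<in> group_words A"
  using word_cong_closed[OF assms group_words_append] by auto

lemma group_base:
  "(g, h) \<in> cancellations A \<union> subgroup_relations P Q T
    \<Longrightarrow> g \<in> group_words A \<Longrightarrow> h \<in> group_words A \<Longrightarrow> g \<simeq> h"
  by (rule word_cong.base)

lemma group_loop: "p \<in> Q \<Longrightarrow> [Pos (p, p)] \<simeq> []"
  by (rule group_base) (auto simp: subgroup_relations_def A_refl)

lemma group_cancel: "(p, q) \<in> A \<Longrightarrow> [Pos (p, q), Neg (p, q)] \<simeq> []"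
  by (rule group_base) (simp add: cancellations_def; blast)+

lemma group_swap: "(p, q) \<in> A \<Longrightarrow> [Pos (p, q)] \<simeq> [Neg (q, p)]"
  by (rule group_base)
    (auto simp: subgroup_relations_def A_sym, auto simp: subgroup_generators_def)

text \<open>By \<open>group_swap\<close> the letter of the return edge is the inverse of the
  outgoing one.\<close>

lemma group_back:
  assumes "(p, q) \<in> A"
  shows "[Pos (p, q), Pos (q, p)] \<simeq> []"
proof -
  have "[Pos (p, q)] @ [Pos (q, p)] @ [] \<simeq> [Pos (p, q)] @ [Neg (p, q)] @ []"
    using assms by (intro group_context group_swap) (auto intro: A_sym)
  also have "[Pos (p, q)] @ [Neg (p, q)] @ [] \<simeq> []"
    using group_cancel assms by simp
  finally show ?thesis by simp
qed

lemma group_tree: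
  assumes "(p, q) \<in> parcs T"
  shows "[Pos (p, q)] \<simeq> []" and "[Pos (q, p)] \<simeq> []"
proof -
  show *: "[Pos (p, q)] \<simeq> []"
    using assms by (intro group_base) (auto simp: subgroup_relations_def arc_A)
  have A: "(q, p) \<in> A" using assms arc_A A_sym by blast
  have "[Pos (q, p)] @ [] @ [] \<simeq> [Pos (q, p)] @ [Pos (p, q)] @ []"
    using A by (intro group_context word_cong.sym[OF *]) auto
  also have "[Pos (q, p)] @ [Pos (p, q)] @ [] \<simeq> []"
    using group_back A by simp
  finally show "[Pos (q, p)] \<simeq> []" by simp
qed

lemma group_diamond:
  assumes "linked_diamond P Q s u v w"
  shows "[Neg (s, v), Pos (s, w)] \<simeq> [Neg (u, v), Pos (u, w)]"
  using assms
  by (intro group_base)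
    (auto simp: subgroup_relations_def, auto simp: linked_diamond_def subgroup_generators_def)

section \<open>The action of PG(P) on the component\<close>

lemma target_in: "s \<in> Q \<Longrightarrow> set w \<subseteq> carrier P \<Longrightarrow> acts s w \<Longrightarrow> target s w \<in> Q"
proof (induction w arbitrary: s)
  case (Cons p w)
  then have "p \<triangleright> s \<in> Q" using A_step[of s p] A_iff by auto
  then show ?case using Cons by auto
qed simp

lemma label_in: "s \<in> Q \<Longrightarrow> set w \<subseteq> carrier P \<Longrightarrow> acts s w \<Longrightarrow> label s w \<in> group_words A"
proof (induction w arbitrary: s)
  case (Cons p w)
  then have "(s, p \<triangleright> s) \<in> A" using A_step[of s p] by auto
  then show ?case using Cons A_iff by auto
qed simp

text \<open>The group component is multiplied on the right by the label, so agreement of labels at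
  each state is agreement on all pairs of a state and a group element.\<close>

definition same_action :: "'a list \<Rightarrow> 'a list \<Rightarrow> bool" where
  "same_action u w \<longleftrightarrow> (\<forall>s\<in>Q. (acts s u \<longleftrightarrow> acts s w) \<and>
    (acts s u \<longrightarrow> target s u = target s w \<and> label s u \<simeq> label s w))"

text \<open>The second \<open>p\<close> fixes the state psp and contributes only the loop generator
  there, which is trivial.\<close>

lemma same_action_idem:
  assumes p: "p \<in> carrier P"
  shows "same_action [p, p] [p]"
  unfolding same_action_def
proof
  fix s assume s: "s \<in> Q"
  note c = p Q_in[OF s]
  have "acts s [p, p] = acts s [p]"
    using c by (auto simp: conj self swap)
  moreover have "target s [p, p] = target s [p]"
    using c by (simp add: idem)
  moreover have "label s [p, p] \<simeq> label s [p]" if "acts s [p]"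
  proof -
    have A: "(s, p \<triangleright> s) \<in> A" using that A_step s p by auto
    then have "[Pos (s, p \<triangleright> s)] @ [Pos (p \<triangleright> s, p \<triangleright> s)] @ [] \<simeq> [Pos (s, p \<triangleright> s)] @ [] @ []"
      using A_iff by (intro group_context group_loop) auto
    then show ?thesis using c by (simp add: idem)
  qed
  ultimately show "(acts s [p, p] \<longleftrightarrow> acts s [p]) \<and>
    (acts s [p, p] \<longrightarrow> target s [p, p] = target s [p] \<and> label s [p, p] \<simeq> label s [p])"
    by blast
qed

lemma same_action_idem2:
  assumes p: "p \<in> carrier P" and q: "q \<in> carrier P"
  shows "same_action [p, q, p, q] [p, q]"
  unfolding same_action_def
proof
  fix s assume s: "s \<in> Q"
  note c = p q Q_in[OF s]
  \<comment> \<open>The walk visits \<open>s\<close>, \<open>v\<close>, \<open>w\<close>,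
    \<open>y\<close> and then returns to \<open>w\<close>, so its last two edges cancel.\<close>
  define v w y where "v = p \<triangleright> s" and "w = q \<triangleright> v" and "y = p \<triangleright> w"
  have w: "q \<triangleright> y = w" using c by (simp add: v_def w_def y_def idem2)
  \<comment> \<open>Both further letters act by \<open>absorb_back\<close>, used first at
    \<open>s\<close> and then at \<open>v\<close> with \<open>p\<close> and \<open>q\<close>
    exchanged.\<close>
  have return: "w \<triangleright> p = w \<and> y \<triangleright> q = y" if "s \<triangleright> p = s" "v \<triangleright> q = v"
  proof
    show *: "w \<triangleright> p = w" using that c absorb_back by (auto simp: v_def w_def)
    show "y \<triangleright> q = y" using that c * absorb_back[of v q p] closed by (auto simp: v_def w_def y_def)
  qed
  have "acts s [p, q, p, q] = acts s [p, q]"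
    using return by (auto simp: v_def w_def y_def)
  moreover have "target s [p, q, p, q] = target s [p, q]"
    using w by (simp add: v_def w_def y_def)
  moreover have "label s [p, q, p, q] \<simeq> label s [p, q]" if "acts s [p, q]"
  proof -
    have sv: "(s, v) \<in> A" using that A_step s p by (auto simp: v_def)
    have vw: "(v, w) \<in> A" using that A_step[of v q] sv q A_iff by (auto simp: v_def w_def)
    have wy: "(w, y) \<in> A"
      using that A_step[of w p] vw p return A_iff by (auto simp: v_def y_def)
    have "[Pos (s, v), Pos (v, w)] @ [Pos (w, y), Pos (y, w)] @ [] \<simeq> [Pos (s, v), Pos (v, w)] @ [] @ []"
      using sv vw by (intro group_context group_back wy) auto
    then show ?thesis using w by (simp add: v_def w_def y_def)
  qed
  ultimately show "(acts s [p, q, p, q] \<longleftrightarrow> acts s [p, q]) \<and> (acts s [p, q, p, q] \<longrightarrow>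
      target s [p, q, p, q] = target s [p, q] \<and> label s [p, q, p, q] \<simeq> label s [p, q])"
    by blast
qed

lemma same_action_conj:
  assumes p: "p \<in> carrier P" and q: "q \<in> carrier P"
  shows "same_action [p, q, p] [p \<triangleright> q]"
  unfolding same_action_def
proof
  fix s assume s: "s \<in> Q"
  note c = p q Q_in[OF s]
  define v w y where "v = p \<triangleright> s" and "w = q \<triangleright> v" and "y = p \<triangleright> w"
  have y: "(p \<triangleright> q) \<triangleright> s = y" using c by (simp add: v_def w_def y_def conj)
  have eq: "acts s [p, q, p] = acts s [p \<triangleright> q]"
    unfolding acts.simps absorb_iff[OF c(3,1,2)] using absorb_back[OF c(3,1,2)] by blast
  moreover have "target s [p, q, p] = target s [p \<triangleright> q]"
    using y by (simp add: v_def w_def y_def)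
  moreover have "label s [p, q, p] \<simeq> label s [p \<triangleright> q]" if "acts s [p, q, p]"
  proof -
    have sv: "(s, v) \<in> A" using that A_step s p by (auto simp: v_def)
    have vw: "(v, w) \<in> A" using that A_step[of v q] sv q A_iff by (auto simp: v_def w_def)
    have wy: "(w, y) \<in> A" using that A_step[of w p] vw p A_iff by (auto simp: v_def w_def y_def)
    have sy: "(s, y) \<in> A"
      using that eq A_step[OF s closed[OF p q]] y by simp
    \<comment> \<open>The linking projection is \<open>p\<close>, which sends \<open>s\<close> to
      \<open>v\<close> and \<open>w\<close> to \<open>y\<close>.\<close>
    have "linked_diamond P Q s w v y"
      using sv A_sym[OF vw] wy sy p
      by (auto simp: linked_diamond_def subgroup_generators_def v_def y_def)
    note diamond = word_cong.sym[OF group_diamond[OF this]]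
    \<comment> \<open>The middle edge is reversed so that it forms, with the last edge, one side of
      the diamond relation. The other side begins with the inverse of the first edge, and only the
      edge from \<open>s\<close> to \<open>y\<close> survives.\<close>
    have "[Pos (s, v)] @ [Pos (v, w)] @ [Pos (w, y)] \<simeq> [Pos (s, v)] @ [Neg (w, v)] @ [Pos (w, y)]"
      using sv wy by (intro group_context group_swap vw) auto
    also have "[Pos (s, v)] @ [Neg (w, v)] @ [Pos (w, y)] \<simeq> [Pos (s, v)] @ [Neg (s, v), Pos (s, y)]"
      using group_context[OF diamond, of "[Pos (s, v)]" "[]"] sv by simp
    also have "[Pos (s, v)] @ [Neg (s, v), Pos (s, y)] \<simeq> [Pos (s, y)]"
      using group_context[OF group_cancel[OF sv], of "[]" "[Pos (s, y)]"] sy by simp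
    finally show ?thesis using y by (simp add: v_def w_def y_def)
  qed
  ultimately show "(acts s [p, q, p] \<longleftrightarrow> acts s [p \<triangleright> q]) \<and> (acts s [p, q, p] \<longrightarrow>
      target s [p, q, p] = target s [p \<triangleright> q] \<and> label s [p, q, p] \<simeq> label s [p \<triangleright> q])"
    by blast
qed

text \<open>The defining relations are settled by the three preceding lemmas. Compatibility with a
  prefix holds because the prefix keeps the state in \<open>Q\<close>, where the hypothesis on the
  suffixes applies.\<close>

lemma PG_same_action:
  assumes "u \<approx> w"
  shows "same_action u w"
  using assms
proof (induction rule: word_cong.induct)
  case (base u v)
  then show ?case
    using same_action_idem same_action_idem2 same_action_conj by (auto simp: PG_relations_def)
next
  case (refl u)
  then show ?case
    using label_in group_refl by (auto simp: same_action_def semigroup_words_def)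
next
  case (sym u v)
  then show ?case by (auto simp: same_action_def intro: word_cong.sym)
next
  case (trans u v w)
  show ?case
    unfolding same_action_def
  proof
    fix s assume "s \<in> Q"
    then show "(acts s u \<longleftrightarrow> acts s w) \<and>
        (acts s u \<longrightarrow> target s u = target s w \<and> label s u \<simeq> label s w)"
      using trans.IH unfolding same_action_def by (auto intro: word_cong.trans)
  qed
next
  case (left u v w)
  have w: "set w \<subseteq> carrier P" using left.hyps by (auto simp: semigroup_words_def)
  show ?case
    unfolding same_action_def
  proof
    fix s assume s: "s \<in> Q"
    show "(acts s (w @ u) \<longleftrightarrow> acts s (w @ v)) \<and> (acts s (w @ u) \<longrightarrow>
        target s (w @ u) = target s (w @ v) \<and> label s (w @ u) \<simeq> label s (w @ v))"
    proof (cases "acts s w")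
      case True
      then have "target s w \<in> Q" "label s w \<simeq> label s w"
        using target_in label_in group_refl s w by auto
      then show ?thesis
        using True left.IH group_append by (simp add: same_action_def)
    qed simp
  qed
next
  case (right u v w)
  have w: "set w \<subseteq> carrier P" "set u \<subseteq> carrier P" "set v \<subseteq> carrier P"
    using right.hyps PG_closed[of u v] by (auto simp: semigroup_words_def)
  show ?case
    unfolding same_action_def
  proof
    fix s assume s: "s \<in> Q"
    show "(acts s (u @ w) \<longleftrightarrow> acts s (v @ w)) \<and> (acts s (u @ w) \<longrightarrow>
        target s (u @ w) = target s (v @ w) \<and> label s (u @ w) \<simeq> label s (v @ w))"
    proof (cases "acts s u")
      case True
      then have *: "acts s v" "target s u = target s v" "label s u \<simeq> label s v"
        using right.IH s by (auto simp: same_action_def)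
      moreover have "target s v \<in> Q" using target_in s w * by blast
      ultimately show ?thesis
        using True w label_in group_append group_refl by simp
    next
      case False
      then show ?thesis using right.IH s by (auto simp: same_action_def)
    qed
  qed
qed

lemma PG_acts: "u \<approx> w \<Longrightarrow> s \<in> Q \<Longrightarrow> acts s u \<longleftrightarrow> acts s w"
  and PG_target: "u \<approx> w \<Longrightarrow> s \<in> Q \<Longrightarrow> acts s u \<Longrightarrow> target s u = target s w"
  and PG_label: "u \<approx> w \<Longrightarrow> s \<in> Q \<Longrightarrow> acts s u \<Longrightarrow> label s u \<simeq> label s w"
  using PG_same_action by (auto simp: same_action_def)

section \<open>Tree paths as words of PG(P)\<close>

lemma path_carrier: "p \<in> Q \<Longrightarrow> set (t p) \<subseteq> carrier P"
  using path(1) Q_carrier by blast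

lemma path_friendly:
  assumes "p \<in> Q"
  shows "successively (\<lambda>x y. (x, y) \<in> friendliness P) (t p)"
    and "successively (\<lambda>x y. (x, y) \<in> friendliness P) (rev (t p))"
proof -
  show "successively (\<lambda>x y. (x, y) \<in> friendliness P) (t p)"
    by (rule successively_mono[OF path(5)[OF assms]]) (use arcs in auto)
  show "successively (\<lambda>x y. (x, y) \<in> friendliness P) (rev (t p))"
    unfolding successively_rev
    by (rule successively_mono[OF path(5)[OF assms]]) (use arcs friendly_sym in auto)
qed

lemma path_out_back: "p \<in> Q \<Longrightarrow> t p @ rev (t p) \<approx> [r]"
  using PG_path_rev[OF path_friendly(1)] path path_carrier by simp

lemma path_back_out: "p \<in> Q \<Longrightarrow> rev (t p) @ t p \<approx> [p]"
  using PG_path_rev[OF path_friendly(2)] path path_carrier by (simp add: hd_rev)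

lemma path_absorb:
  assumes "p \<in> Q"
  shows "t p @ [p] \<approx> t p" and "rev (t p) @ [r] \<approx> rev (t p)"
  using assms PG_absorb_last[of "t p"] PG_absorb_last[of "rev (t p)"]
    path path_carrier by (simp_all add: last_rev)

text \<open>The excursion to \<open>q\<close> contracts at the end of the path since
  \<open>p\<close> and \<open>q\<close> are friendly; what remains is the path out and back.\<close>

lemma path_detour:
  assumes "(p, q) \<in> A"
  shows "t p @ [q] @ rev (t p) \<approx> [r]"
proof -
  have Q: "p \<in> Q" "q \<in> Q" using assms A_iff by auto
  note c = path_carrier[OF Q(1)] Q_in[OF Q(1)] Q_in[OF Q(2)]
  obtain u where u: "t p = u @ [p]"
    using path(2,4)[OF Q(1)] by (metis append_butlast_last_id)
  have "u @ [p, q, p] @ rev u \<approx> u @ [p] @ rev u"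
    using c u by (intro PG_context PG_friendly A_friendly assms) auto
  also have "u @ [p] @ rev u \<approx> u @ [p, p] @ rev u"
    using c u by (intro PG_context word_cong.sym[OF PG_idem]) auto
  also have "u @ [p, p] @ rev u \<approx> [r]"
    using path_out_back[OF Q(1)] u by simp
  finally show ?thesis using u by simp
qed

section \<open>From group words to loops at the root\<close>

text \<open>The edge from \<open>p\<close> to \<open>q\<close> is the junction of two tree paths:
  \<open>t p\<close> ends in \<open>p\<close>, and \<open>rev (t q)\<close> starts with
  \<open>q\<close>. A negative letter receives the reversed word.\<close>

fun letter_word :: "('a \<times> 'a) letter \<Rightarrow> 'a list" where
  "letter_word (Pos (p, q)) = t p @ rev (t q)"
| "letter_word (Neg (p, q)) = t q @ rev (t p)"

text \<open>The leading \<open>r\<close> keeps the word nonempty and stands for the identity when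
  \<open>g\<close> is empty.\<close>

definition loop_word :: "('a \<times> 'a) letter list \<Rightarrow> 'a list" where
  "loop_word g = r # concat (map letter_word g)"

lemma loop_word_Nil [simp]: "loop_word [] = [r]"
  by (simp add: loop_word_def)

lemma loop_word_append1: "loop_word (g @ h) = loop_word g @ concat (map letter_word h)"
  by (simp add: loop_word_def)

lemma letter_word_carrier: "[x] \<in> group_words A \<Longrightarrow> set (letter_word x) \<subseteq> carrier P"
  using path_carrier A_iff by (cases x rule: letter_word.cases) auto

lemma letter_words_carrier:
  "g \<in> group_words A \<Longrightarrow> set (concat (map letter_word g)) \<subseteq> carrier P"
proof (induction g)
  case (Cons x g)
  then have "[x] \<in> group_words A" "g \<in> group_words A"
    by (cases x; simp)+
  then show ?case using Cons.IH letter_word_carrier by auto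
qed simp

lemma loop_word_carrier: "g \<in> group_words A \<Longrightarrow> set (loop_word g) \<subseteq> carrier P"
  using letter_words_carrier root Q_in by (simp add: loop_word_def)

lemma loop_word_nonempty: "loop_word g \<noteq> []"
  by (simp add: loop_word_def)

text \<open>Tree paths start at the root, so each \<open>letter_word\<close> ends in
  \<open>r\<close> and absorbs one more copy.\<close>

lemma loop_word_root:
  assumes "g \<in> group_words A"
  shows "loop_word g @ [r] \<approx> loop_word g"
proof (cases g rule: rev_cases)
  case Nil
  then show ?thesis using PG_idem root Q_in by simp
next
  case (snoc h x)
  obtain p q where pq: "letter_word x = t p @ rev (t q)" "p \<in> Q" "q \<in> Q"
    using assms A_iff unfolding snoc by (cases x rule: letter_word.cases) auto
  have h: "h \<in> group_words A" using assms snoc by simp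
  have "(loop_word h @ t p) @ (rev (t q) @ [r]) @ [] \<approx> (loop_word h @ t p) @ rev (t q) @ []"
    using loop_word_carrier[OF h] path_carrier pq by (intro PG_context path_absorb) auto
  then show ?thesis using snoc pq by (simp add: loop_word_def)
qed

lemma loop_word_append:
  assumes "g \<in> group_words A" "h \<in> group_words A"
  shows "loop_word g @ loop_word h \<approx> loop_word (g @ h)"
  using PG_context[OF loop_word_root[OF assms(1)], of "[]" "concat (map letter_word h)"]
    letter_words_carrier[OF assms(2)] by (simp add: loop_word_def)

text \<open>Without the leading root, the empty group word has no counterpart in the free semigroup;
  \<open>[r]\<close> stands in for it.\<close>

lemma loop_word_base:
  assumes "(g, h) \<in> cancellations A \<union> subgroup_relations P Q T" "g \<in> group_words A" "h \<in> group_words A"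
  shows "concat (map letter_word g) \<approx> (if h = [] then [r] else concat (map letter_word h))"
proof -
  \<comment> \<open>This covers both free cancellations: the inner \<open>rev (t q) @ t q\<close>
    shrinks to \<open>q\<close>, which leaves a detour.\<close>
  have cancel: "t p @ rev (t q) @ t q @ rev (t p) \<approx> [r]" if pq: "(p, q) \<in> A" for p q
  proof -
    have "p \<in> Q" "q \<in> Q" using pq A_iff by auto
    then have "t p @ (rev (t q) @ t q) @ rev (t p) \<approx> t p @ [q] @ rev (t p)"
      using path_carrier by (intro PG_context path_back_out) auto
    also have "t p @ [q] @ rev (t p) \<approx> [r]"
      by (rule path_detour[OF pq])
    finally show ?thesis by simp
  qed
  \<comment> \<open>Prepares the use of \<open>PG_diamond\<close>: the two tree paths at
    \<open>s\<close> shrink to the letter \<open>s\<close>, and copies of \<open>v\<close> and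
    \<open>w\<close> are split off the outer paths.\<close>
  have middle: "t v @ rev (t s) @ t s @ rev (t w) \<approx> t v @ [v, s, w] @ rev (t w)"
    if sv: "(s, v) \<in> A" and sw: "(s, w) \<in> A" for s v w
  proof -
    have Q: "s \<in> Q" "v \<in> Q" "w \<in> Q" using sv sw A_iff by auto
    have rev: "[w] @ rev (t w) \<approx> rev (t w)"
      using Q PG_absorb_hd[of "rev (t w)"] path path_carrier by (simp add: hd_rev)
    have "t v @ (rev (t s) @ t s) @ rev (t w) \<approx> t v @ [s] @ rev (t w)"
      using Q path_carrier by (intro PG_context path_back_out) auto
    also have "t v @ [s] @ rev (t w) \<approx> (t v @ [v]) @ [s] @ ([w] @ rev (t w))"
      using Q Q_in by (intro PG_append word_cong.sym[OF path_absorb(1)] word_cong.sym[OF rev] PG_refl)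
        auto
    finally show ?thesis by simp
  qed
  from assms(1) consider
      (pn) p q where "g = [Pos (p, q), Neg (p, q)]" "h = []"
    | (np) p q where "g = [Neg (p, q), Pos (p, q)]" "h = []"
    | (tree) p q where "g = [Pos (p, q)]" "h = []" "(p, q) \<in> parcs T"
    | (loop) p where "g = [Pos (p, p)]" "h = []" "p \<in> Q"
    | (swap) p q where "g = [Pos (p, q)]" "h = [Neg (q, p)]"
    | (diamond) s u v w where "g = [Neg (s, v), Pos (s, w)]" "h = [Neg (u, v), Pos (u, w)]"
        "linked_diamond P Q s u v w"
    unfolding cancellations_def subgroup_relations_def by fast
  then show ?thesis
  proof cases
    case pn
    then show ?thesis using cancel assms(2) by simp
  next
    case np
    then show ?thesis using cancel A_sym assms(2) by simp
  next
    case tree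
    \<comment> \<open>Since \<open>t q = t p @ [q]\<close>, the word is the detour from
      \<open>p\<close> to \<open>q\<close> and back.\<close>
    then show ?thesis using path_detour[OF arc_A[OF tree(3)]] path_arc by simp
  next
    case loop
    then show ?thesis using path_out_back by simp
  next
    case swap
    then have "p \<in> Q" "q \<in> Q" using assms(2) A_iff by auto
    \<comment> \<open>Both letters translate into literally the same word.\<close>
    then show ?thesis
      using swap path_carrier[of p] path_carrier[of q] path(2)[of p] by (simp add: PG_refl)
  next
    case diamond
    have Q: "v \<in> Q" "w \<in> Q" using diamond assms(2) A_iff by auto
    have "t v @ rev (t s) @ t s @ rev (t w) \<approx> t v @ [v, s, w] @ rev (t w)"
      using diamond assms(2) by (intro middle) auto
    also have "t v @ [v, s, w] @ rev (t w) \<approx> t v @ [v, u, w] @ rev (t w)"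
      using Q path_carrier by (intro PG_context PG_diamond[OF diamond(3)]) auto
    also have "t v @ [v, u, w] @ rev (t w) \<approx> t v @ rev (t u) @ t u @ rev (t w)"
      using diamond assms(3) by (intro word_cong.sym[OF middle]) auto
    finally show ?thesis using diamond by simp
  qed
qed

lemma loop_word_cong:
  assumes "g \<simeq> h"
  shows "loop_word g \<approx> loop_word h"
  using assms
proof (induction rule: word_cong.induct)
  case (base g h)
  have r: "r \<in> carrier P" using root Q_in by simp
  have "[r] @ concat (map letter_word g) @ []
      \<approx> [r] @ (if h = [] then [r] else concat (map letter_word h)) @ []"
    using loop_word_base[OF base] r by (intro PG_context) auto
  then show ?case
    using PG_idem[OF r] by (cases "h = []") (auto simp: loop_word_def intro: word_cong.trans)
next
  case (refl g)
  then show ?case using loop_word_carrier loop_word_nonempty PG_refl by blast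
next
  case (sym g h)
  show ?case by (rule word_cong.sym[OF sym.IH])
next
  case (trans g h k)
  then show ?case by (blast intro: word_cong.trans)
next
  case (left g h k)
  note c = group_closed[OF left.hyps(1)]
  have "loop_word (k @ g) \<approx> loop_word k @ loop_word g"
    using loop_word_append[OF left.hyps(2) c(1)] by (rule word_cong.sym)
  also have "loop_word k @ loop_word g \<approx> loop_word k @ loop_word h"
    using left loop_word_carrier loop_word_nonempty by (intro PG_append PG_refl)
  also have "loop_word k @ loop_word h \<approx> loop_word (k @ h)"
    by (rule loop_word_append[OF left.hyps(2) c(2)])
  finally show ?case .
next
  case (right g h k)
  note c = group_closed[OF right.hyps(1)]
  show ?case
    using PG_context[OF right.IH, of "[]" "concat (map letter_word k)"]
      letter_words_carrier[OF right.hyps(2)] by (simp add: loop_word_append1)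
qed

section \<open>Labels of loops, and recovery of words from labels\<close>

text \<open>Along a friendliness edge the new state is the acting letter itself. So the word spells
  its own walk, and its label is the product of the edge generators, all trivial here.\<close>

lemma silent_path:
  assumes "successively (\<lambda>x y. (x, y) \<in> A \<and> [Pos (x, y)] \<simeq> []) (s # u)"
  shows "acts s u \<and> target s u = last (s # u) \<and> label s u \<simeq> []"
  using assms
proof (induction u arbitrary: s)
  case Nil
  then show ?case by (simp add: group_refl)
next
  case (Cons p u)
  then have A: "(s, p) \<in> A" and triv: "[Pos (s, p)] \<simeq> []"
    and IH: "acts p u" "target p u = last (p # u)" "label p u \<simeq> []"
    by (auto simp: successively_Cons)
  have "[Pos (s, p)] @ label p u \<simeq> [] @ []"
    by (rule group_append[OF triv IH(3)])
  then show ?case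
    using A IH by (simp add: A_iff)
qed

lemma tree_paths:
  assumes "p \<in> Q"
  shows "acts r (t p)" "target r (t p) = p" "label r (t p) \<simeq> []"
    and "acts p (rev (t p))" "target p (rev (t p)) = r" "label p (rev (t p)) \<simeq> []"
proof -
  let ?E = "\<lambda>x y. (x, y) \<in> A \<and> [Pos (x, y)] \<simeq> []"
  have "successively ?E (t p)"
    by (rule successively_mono[OF path(5)[OF assms]]) (use group_tree arc_A in auto)
  \<comment> \<open>The first letter of \<open>t p\<close> is \<open>r\<close>, so the walk from
    \<open>r\<close> begins with the loop at \<open>r\<close>.\<close>
  moreover have "?E r r"
    using group_loop A_refl root by simp
  ultimately have "successively ?E (r # t p)"
    using path assms by (auto simp: successively_Cons)
  from silent_path[OF this]
  show "acts r (t p)" "target r (t p) = p" "label r (t p) \<simeq> []"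
    using path assms by auto
  have "successively ?E (rev (t p))"
    unfolding successively_rev
    by (rule successively_mono[OF path(5)[OF assms]]) (use group_tree arc_A A_sym in auto)
  moreover have "?E p p"
    using group_loop A_refl assms by simp
  ultimately have "successively ?E (p # rev (t p))"
    using path assms by (auto simp: successively_Cons hd_rev)
  from silent_path[OF this]
  show "acts p (rev (t p))" "target p (rev (t p)) = r" "label p (rev (t p)) \<simeq> []"
    using path assms by (auto simp: last_rev)
qed

lemma edge_path:
  assumes pq: "(p, q) \<in> A"
  shows "acts r (t p @ rev (t q))" "target r (t p @ rev (t q)) = r"
    and "label r (t p @ rev (t q)) \<simeq> [Pos (p, q)]"
proof -
  have Q: "p \<in> Q" "q \<in> Q" using pq A_iff by auto
  obtain u where u: "rev (t q) = q # u"
    using path(2,4)[OF Q(2)] by (metis append_butlast_last_id rev_eq_Cons_iff rev_rev_ident)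
  have qq: "q \<triangleright> q = q" and pq': "p \<triangleright> q = p" "q \<triangleright> p = q"
    using self Q_in Q pq A_iff by auto
  note tail = tree_paths(4-6)[OF Q(2), unfolded u]
  show "acts r (t p @ rev (t q))" "target r (t p @ rev (t q)) = r"
    using tree_paths(1,2)[OF Q(1)] tail qq pq' u by auto
  have in_A: "label q u \<in> group_words A"
    using group_closed(1)[OF tail(3)] qq by simp
  \<comment> \<open>The triviality of the return path from \<open>q\<close> includes the loop at
    \<open>q\<close>. Here the letter \<open>q\<close> is reached from \<open>p\<close> instead, so
    the loop has to be split off.\<close>
  have "label q u \<simeq> label q (q # u)"
    using group_append[OF word_cong.sym[OF group_loop[OF Q(2)]] group_refl[OF in_A]] qq by simp
  also have "label q (q # u) \<simeq> []"
    by (rule tail(3))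
  finally have "label r (t p) @ [Pos (p, q)] @ label q u \<simeq> [] @ [Pos (p, q)] @ []"
    using pq by (intro group_append tree_paths(3) Q group_refl) auto
  then show "label r (t p @ rev (t q)) \<simeq> [Pos (p, q)]"
    using tree_paths(2)[OF Q(1)] pq' u by simp
qed

lemma letter_word_path:
  assumes "[x] \<in> group_words A"
  shows "acts r (letter_word x) \<and> target r (letter_word x) = r \<and> label r (letter_word x) \<simeq> [x]"
proof (cases x rule: letter_word.cases)
  case (1 p q)
  then show ?thesis using edge_path assms by simp
next
  case (2 p q)
  then have "(q, p) \<in> A" using assms A_sym by simp
  then show ?thesis
    using edge_path[of q p] group_swap[of q p] 2 by (auto intro: word_cong.trans)
qed

lemma letter_words_path:
  assumes "g \<in> group_words A"
  shows "acts r (concat (map letter_word g)) \<and> target r (concat (map letter_word g)) = r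
    \<and> label r (concat (map letter_word g)) \<simeq> g"
  using assms
proof (induction g)
  case Nil
  then show ?case by (simp add: group_refl)
next
  case (Cons x g)
  then have x: "[x] \<in> group_words A" and g: "g \<in> group_words A"
    by (cases x; simp)+
  have "label r (letter_word x) @ label r (concat (map letter_word g)) \<simeq> [x] @ g"
    using letter_word_path[OF x] Cons.IH[OF g] by (intro group_append) auto
  then show ?case using letter_word_path[OF x] Cons.IH[OF g] by simp
qed

lemma label_loop_word:
  assumes "g \<in> group_words A"
  shows "label r (loop_word g) \<simeq> g"
proof -
  have rr: "r \<triangleright> r = r" using self root Q_in by simp
  have "[Pos (r, r)] @ label r (concat (map letter_word g)) \<simeq> [] @ g"
    using letter_words_path[OF assms] root by (intro group_append group_loop) auto
  then show ?thesis by (simp add: loop_word_def rr)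
qed

text \<open>The factor \<open>t (target r w)\<close> lets the induction pass through words that end
  away from the root: an appended letter replaces the tree path to the old state by that to the new
  one.\<close>

lemma loop_word_label:
  assumes "set w \<subseteq> carrier P" "acts r w"
  shows "loop_word (label r w) @ t (target r w) \<approx> r # w"
  using assms
proof (induction w rule: rev_induct)
  case Nil
  then show ?case using PG_idem root Q_in by simp
next
  case (snoc p w)
  define s v where "s = target r w" and "v = p \<triangleright> s"
  have w: "set w \<subseteq> carrier P" "acts r w" and p: "p \<in> carrier P" "s \<triangleright> p = s"
    using snoc.prems by (auto simp: s_def)
  have s: "s \<in> Q" using target_in[OF root(1) w] by (simp add: s_def)
  then have v: "v \<in> Q" using A_step p A_iff by (auto simp: v_def)
  let ?g = "loop_word (label r w)"
  have g: "set ?g \<subseteq> carrier P" using loop_word_carrier label_in root w by blast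
  note c = g path_carrier[OF s] path_carrier[OF v] Q_in[OF s] Q_in[OF v] p(1)
  have "?g @ t s @ (rev (t v) @ t v) \<approx> ?g @ t s @ [v]"
    using PG_context[OF path_back_out[OF v], of "?g @ t s" "[]"] c by simp
  also have "?g @ t s @ [v] \<approx> ?g @ (t s @ [s]) @ [v]"
    using PG_context[OF word_cong.sym[OF path_absorb(1)[OF s]], of ?g "[v]"] c by simp
  \<comment> \<open>After the letter \<open>s\<close>, the letter \<open>p\<close> and the state
    \<open>v\<close> to which it leads are interchangeable.\<close>
  also have "?g @ (t s @ [s]) @ [v] \<approx> ?g @ (t s @ [s]) @ [p]"
    using PG_context[OF word_cong.sym[OF PG_step[of s p]], of "?g @ t s" "[]"] c
    by (simp add: v_def)
  also have "?g @ (t s @ [s]) @ [p] \<approx> ?g @ t s @ [p]"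
    using PG_context[OF path_absorb(1)[OF s], of ?g "[p]"] c by simp
  also have "?g @ t s @ [p] \<approx> (r # w) @ [p]"
    using PG_context[OF snoc.IH[OF w], of "[]" "[p]"] c by (simp add: s_def)
  finally show ?case
    by (simp add: s_def v_def loop_word_append1)
qed

text \<open>The first three hypotheses still allow the target of \<open>w\<close> to be a projection strictly below \<open>r\<close>; the
  last one excludes this.\<close>

lemma maximal_subgroup_word:
  assumes "r # w \<approx> w" "w @ [r] \<approx> w" "w @ x \<approx> [r]" "y @ w \<approx> [r]"
  shows "acts r w" "target r w = r" "loop_word (label r w) \<approx> w"
proof -
  have r: "r \<in> carrier P" "r \<triangleright> r = r" using root Q_in self by auto
  have w: "set w \<subseteq> carrier P" "w \<noteq> []" using PG_closed(3,4)[OF assms(1)] .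
  have y: "set y \<subseteq> carrier P" using PG_closed(1)[OF assms(4)] by simp
  have "acts r (w @ x)"
    using PG_acts[OF assms(3) root(1)] r by simp
  then show acts: "acts r w" by simp
  define s where "s = target r w"
  have s: "s \<in> Q" using target_in[OF root(1) w(1) acts] by (simp add: s_def)
  have sr: "s \<triangleright> r = s"
    using PG_acts[OF assms(2) root(1)] acts by (simp add: s_def)
  let ?g = "loop_word (label r w)"
  have g: "set ?g \<subseteq> carrier P"
    by (rule loop_word_carrier[OF label_in[OF root(1) w(1) acts]])
  have gw: "?g @ t s \<approx> w"
    using loop_word_label[OF w(1) acts] assms(1) by (auto simp: s_def intro: word_cong.trans)
  \<comment> \<open>The word \<open>w\<close> is congruent to one ending in its target
    \<open>s\<close>, hence absorbs \<open>s\<close>. Multiplying by \<open>y\<close> gives rs = r,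
    whose action at \<open>r\<close> yields srs = r, while \<open>sr\<close> states srs = s.\<close>
  have "w @ [s] \<approx> (?g @ t s) @ [s]"
    using PG_context[OF word_cong.sym[OF gw], of "[]" "[s]"] s Q_in by simp
  also have "(?g @ t s) @ [s] \<approx> ?g @ t s"
    using PG_context[OF path_absorb(1)[OF s] g, of "[]"] by simp
  also note gw
  finally have ws: "w @ [s] \<approx> w" .
  have "[r] @ [s] \<approx> (y @ w) @ [s]"
    using s Q_in by (intro PG_append word_cong.sym[OF assms(4)] PG_refl) auto
  also have "(y @ w) @ [s] \<approx> y @ w"
    using PG_context[OF ws y, of "[]"] by simp
  also note assms(4)
  finally have "[r, s] \<approx> [r]" by simp
  then have "s \<triangleright> r = r"
    using PG_target[of "[r, s]" "[r]" r] PG_acts[of "[r, s]" "[r]" r] root(1) r by simp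
  then have "s = r" using sr by simp
  then show "target r w = r" by (simp add: s_def)
  have "?g \<approx> ?g @ t s"
    using loop_word_root[OF label_in[OF root(1) w(1) acts]] root \<open>s = r\<close> by (simp add: word_cong.sym)
  also note gw
  finally show "?g \<approx> w" .
qed

section \<open>The isomorphism induced by labels\<close>

lemma loop_word_in_maximal_subgroup:
  assumes "g \<in> group_words A"
  shows "r # loop_word g \<approx> loop_word g" "loop_word g @ [r] \<approx> loop_word g"
    and "loop_word g @ loop_word (word_inverse g) \<approx> [r]"
    and "loop_word (word_inverse g) @ loop_word g \<approx> [r]"
proof -
  have r: "r \<in> carrier P" using root Q_in by auto
  note inv = word_inverse_closed[OF assms]
  show "r # loop_word g \<approx> loop_word g"
    using PG_absorb_hd[OF loop_word_carrier[OF assms] loop_word_nonempty] by (simp add: loop_word_def)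
  show "loop_word g @ [r] \<approx> loop_word g"
    by (rule loop_word_root[OF assms])
  have "loop_word (g @ word_inverse g) \<approx> loop_word []"
    "loop_word (word_inverse g @ g) \<approx> loop_word []"
    by (intro loop_word_cong word_inverse_left word_inverse_right assms)+
  then show "loop_word g @ loop_word (word_inverse g) \<approx> [r]"
    "loop_word (word_inverse g) @ loop_word g \<approx> [r]"
    using loop_word_append[OF assms inv] loop_word_append[OF inv assms]
    by (auto intro: word_cong.trans)
qed

lemma maximal_subgroup_iso:
  "maximal_subgroup (PG P) (PG_gen P r) \<cong> group_presentation A (subgroup_relations P Q T)"
proof -
  let ?c = "word_cong (semigroup_words (carrier P)) (PG_relations P)"
  let ?d = "word_cong (group_words A) (cancellations A \<union> subgroup_relations P Q T)"
  let ?M = "maximal_subgroup (PG P) (PG_gen P r)"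
  let ?G = "group_presentation A (subgroup_relations P Q T)"
  have r: "r \<in> carrier P" using root Q_in by auto
  have eq_c: "equiv (semigroup_words (carrier P)) ?c"
    by (rule equiv_word_cong[OF semigroup_words_append])
  have eq_d: "equiv (group_words A) ?d"
    by (rule equiv_word_cong[OF group_words_append])
  have mult_c: "class_mult ?c (?c `` {u}) (?c `` {v}) = ?c `` {u @ v}"
    if "u \<in> semigroup_words (carrier P)" "v \<in> semigroup_words (carrier P)" for u v
    by (rule class_mult_word_cong[OF that semigroup_words_append])
  have mult_d: "class_mult ?d (?d `` {g}) (?d `` {h}) = ?d `` {g @ h}"
    if "g \<in> group_words A" "h \<in> group_words A" for g h
    by (rule class_mult_word_cong[OF that group_words_append])
  have carrier_M: "X \<in> carrier ?M \<longleftrightarrow> (\<exists>w. X = ?c `` {w} \<and> w \<in> semigroup_words (carrier P) \<and>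
      (?c `` {[r]}, ?c `` {w}) \<in> green_H (PG P))" for X
  proof -
    have "X \<in> carrier ?M \<longleftrightarrow> (?c `` {[r]}, X) \<in> green_H (PG P)"
      by (simp add: maximal_subgroup_def PG_gen_def)
    moreover have "X \<in> semigroup_words (carrier P) // ?c" if "(?c `` {[r]}, X) \<in> green_H (PG P)"
      using that by (simp add: green_H_def green_L_def PG_def semigroup_presentation_def Let_def)
    ultimately show ?thesis by (auto elim!: quotientE)
  qed
  have carrier_G: "carrier ?G = group_words A // ?d"
    by (simp add: group_presentation_def Let_def)
  \<comment> \<open>The chosen representative is arbitrary; for classes of words that act at
    \<open>r\<close>, \<open>PG_label\<close> makes the value independent of it.\<close>
  define \<phi> where "\<phi> X = ?d `` {label r (SOME w. w \<in> X)}" for X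
  have \<phi>: "\<phi> (?c `` {w}) = ?d `` {label r w}"
    if "w \<in> semigroup_words (carrier P)" "acts r w" for w
  proof -
    have "w \<in> ?c `` {w}" using equiv_class_self[OF eq_c that(1)] .
    then have "(SOME u. u \<in> ?c `` {w}) \<in> ?c `` {w}" by (rule someI)
    then have "label r w \<simeq> label r (SOME u. u \<in> ?c `` {w})"
      using PG_label root that by simp
    then show ?thesis
      unfolding \<phi>_def using equiv_class_eq[OF eq_d] by blast
  qed
  have M_word: "\<exists>w. X = ?c `` {w} \<and> w \<in> semigroup_words (carrier P) \<and> acts r w \<and> target r w = r
      \<and> loop_word (label r w) \<approx> w \<and> label r w \<in> group_words A" if "X \<in> carrier ?M" for X
  proof -
    from iffD1[OF carrier_M that] obtain w where w: "X = ?c `` {w}"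
      "w \<in> semigroup_words (carrier P)" "(?c `` {[r]}, ?c `` {w}) \<in> green_H (PG P)"
      by (elim exE conjE)
    have "r # w \<approx> w \<and> w @ [r] \<approx> w \<and> (\<exists>x. w @ x \<approx> [r]) \<and> (\<exists>y. y @ w \<approx> [r])"
      using w(3) unfolding PG_green_H_iff[OF r w(2)] .
    then obtain x y where "r # w \<approx> w" "w @ [r] \<approx> w" "w @ x \<approx> [r]" "y @ w \<approx> [r]"
      by (elim conjE exE)
    note props = maximal_subgroup_word[OF this]
    have "set w \<subseteq> carrier P" using w(2) by (auto simp: semigroup_words_def)
    then have "label r w \<in> group_words A"
      by (rule label_in[OF root(1) _ props(1)])
    with w(1,2) props show ?thesis by (intro exI conjI)
  qed
  have "\<phi> \<in> iso ?M ?G"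
    unfolding iso_def
  proof (intro CollectI conjI)
    show "\<phi> \<in> hom ?M ?G"
    proof (rule homI)
      fix X assume X: "X \<in> carrier ?M"
      from M_word[OF X] obtain w where "X = ?c `` {w}" "w \<in> semigroup_words (carrier P)"
        "acts r w" "label r w \<in> group_words A" by (elim exE conjE)
      then show "\<phi> X \<in> carrier ?G"
        using \<phi> carrier_G by (simp add: quotientI)
    next
      fix X Y assume X: "X \<in> carrier ?M" and Y: "Y \<in> carrier ?M"
      from M_word[OF X] obtain u where u: "X = ?c `` {u}" "u \<in> semigroup_words (carrier P)"
        "acts r u" "target r u = r" "label r u \<in> group_words A" by (elim exE conjE)
      from M_word[OF Y] obtain v where v: "Y = ?c `` {v}" "v \<in> semigroup_words (carrier P)"
        "acts r v" "label r v \<in> group_words A" by (elim exE conjE)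
      \<comment> \<open>As \<open>u\<close> returns to \<open>r\<close>, the run of \<open>v\<close>
        starts at \<open>r\<close> again and the labels simply concatenate.\<close>
      have "\<phi> (?c `` {u @ v}) = ?d `` {label r u @ label r v}"
        using u v \<phi>[OF semigroup_words_append[OF u(2) v(2)]] by simp
      then show "\<phi> (X \<otimes>\<^bsub>?M\<^esub> Y) = \<phi> X \<otimes>\<^bsub>?G\<^esub> \<phi> Y"
        using u v \<phi> mult_c mult_d
        by (simp add: maximal_subgroup_def PG_def semigroup_presentation_def
            group_presentation_def Let_def)
    qed
    show "bij_betw \<phi> (carrier ?M) (carrier ?G)"
      unfolding bij_betw_def
    proof
      show "inj_on \<phi> (carrier ?M)"
      proof (rule inj_onI)
        fix X Y assume X: "X \<in> carrier ?M" and Y: "Y \<in> carrier ?M" and eq: "\<phi> X = \<phi> Y"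
        from M_word[OF X] obtain u where u: "X = ?c `` {u}" "u \<in> semigroup_words (carrier P)"
          "acts r u" "loop_word (label r u) \<approx> u" "label r u \<in> group_words A" by (elim exE conjE)
        from M_word[OF Y] obtain v where v: "Y = ?c `` {v}" "v \<in> semigroup_words (carrier P)"
          "acts r v" "loop_word (label r v) \<approx> v" "label r v \<in> group_words A" by (elim exE conjE)
        have "?d `` {label r u} = ?d `` {label r v}"
          using eq unfolding u(1) v(1) \<phi>[OF u(2,3)] \<phi>[OF v(2,3)] .
        then have "label r u \<simeq> label r v"
          unfolding eq_equiv_class_iff[OF eq_d u(5) v(5)] .
        \<comment> \<open>Each word is recovered from its label by \<open>loop_word\<close>, so
          labels equal in the group force equal classes.\<close>
        note word_cong.sym[OF u(4)]
        also note loop_word_cong[OF \<open>label r u \<simeq> label r v\<close>]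
        also note v(4)
        finally show "X = Y" using u v equiv_class_eq[OF eq_c] by simp
      qed
      show "\<phi> ` carrier ?M = carrier ?G"
      proof (intro subset_antisym subsetI)
        fix Z assume "Z \<in> \<phi> ` carrier ?M"
        then obtain X where X: "X \<in> carrier ?M" and Z: "Z = \<phi> X" by auto
        from M_word[OF X] obtain w where "X = ?c `` {w}" "w \<in> semigroup_words (carrier P)"
          "acts r w" "label r w \<in> group_words A" by (elim exE conjE)
        then show "Z \<in> carrier ?G"
          using Z \<phi> carrier_G by (simp add: quotientI)
      next
        fix Z assume "Z \<in> carrier ?G"
        then obtain g where g: "g \<in> group_words A" "Z = ?d `` {g}"
          unfolding carrier_G by (rule quotientE)
        \<comment> \<open>The loop of \<open>g\<close> represents the preimage; the loop of the
          inverse word supplies both cofactors required by the H-class.\<close>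
        let ?w = "loop_word g"
        have w: "?w \<in> semigroup_words (carrier P)"
          using loop_word_carrier[OF g(1)] loop_word_nonempty by (auto simp: semigroup_words_def)
        note loop = loop_word_in_maximal_subgroup[OF g(1)]
        have H: "(?c `` {[r]}, ?c `` {?w}) \<in> green_H (PG P)"
          unfolding PG_green_H_iff[OF r w] by (intro conjI exI[of _ "loop_word (word_inverse g)"] loop)
        have M: "?c `` {?w} \<in> carrier ?M"
          unfolding carrier_M by (rule exI[of _ ?w]) (simp only: w H simp_thms)
        have "\<phi> (?c `` {?w}) = Z"
          unfolding \<phi>[OF w maximal_subgroup_word(1)[OF loop]] g(2)
          by (rule equiv_class_eq[OF eq_d label_loop_word[OF g(1)]])
        then show "Z \<in> \<phi> ` carrier ?M"
          by (rule image_eqI[OF HOL.sym M])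
      qed
    qed
  qed
  then show ?thesis by (auto simp: is_iso_def)
qed

end

section \<open>Directed spanning trees\<close>

lemma (in wf_digraph) awalk_successively:
  "awalk u p v \<Longrightarrow> successively (\<lambda>x y. \<exists>e\<in>arcs G. x = tail G e \<and> y = head G e) (awalk_verts u p)"
proof (induction p arbitrary: u)
  case (Cons e p)
  then have "e \<in> arcs G" "awalk (head G e) p v"
    by (auto simp: awalk_Cons_iff)
  then show ?case
    using Cons.IH by (auto simp: successively_Cons)
qed simp

text \<open>The arc closes the path to a directed cycle, which is also a cycle of the
  symmetrization. Length above 2 is excluded by the tree condition; a loop or a pair of opposite
  arcs is excluded by asymmetry.\<close>

lemma (in pair_wf_digraph) underlying_tree_no_return:
  assumes tree: "underlying_tree G" and s: "apath q s p" and pq: "(p, q) \<in> parcs G"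
  shows False
proof -
  let ?S = "mk_symmetric (with_proj G)"
  interpret S: pair_wf_digraph ?S by (rule wellformed_mk_symmetric)
  have asym: "asym (parcs G)" using tree by (simp add: underlying_tree_def)
  let ?cyc = "s @ [(p, q)]"
  have walk: "awalk q s p" and dist: "distinct (pawalk_verts q s)"
    using s by (auto simp: apath_def)
  have cyc: "awalk q ?cyc q"
    using walk pq by (auto simp: awalk_Cons_iff awalk_Nil_iff in_arcsD1 in_arcsD2)
  have hd: "hd (pawalk_verts q s) = q" and last: "last (pawalk_verts q s) = p"
    using walk by auto
  have "S.awalk q ?cyc q"
    using cyc unfolding awalk_def S.awalk_def by (auto simp: parcs_mk_symmetric)
  moreover have "distinct (tl (pawalk_verts q ?cyc))"
  proof -
    obtain xs where xs: "pawalk_verts q s = q # xs"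
      using hd by (metis awalk_verts_non_Nil list.collapse)
    have "pawalk_verts q ?cyc = pawalk_verts q s @ [q]"
      using awalk_verts_append[OF cyc] last by simp
    then show ?thesis using dist xs by simp
  qed
  ultimately have "S.cycle ?cyc"
    unfolding S.cycle_def by auto
  then have "length ?cyc \<le> 2"
    using tree unfolding underlying_tree_def by blast
  then consider "s = []" | e where "s = [e]"
    by (cases s) auto
  then show False
  proof cases
    case 1
    then show False using walk pq asym by (auto simp: awalk_Nil_iff dest: asymD)
  next
    case 2
    then have "e = (q, p)" "e \<in> parcs G"
      using walk by (auto simp: awalk_Cons_iff awalk_Nil_iff)
    then show False using pq asym by (auto dest: asymD)
  qed
qed

text \<open>The list \<open>t p\<close> consists of the vertices on the unique directed path from
  the root to \<open>p\<close>; uniqueness is what forces compatibility with arcs.\<close>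

lemma rooted_spanning_tree_paths:
  fixes T G :: "'a pair_pre_digraph"
  assumes "rooted_spanning_tree r T G"
  obtains t where "t r = [r]"
    and "\<And>p. p \<in> pverts G \<Longrightarrow> set (t p) \<subseteq> pverts G \<and> t p \<noteq> [] \<and> hd (t p) = r \<and> last (t p) = p
      \<and> successively (\<lambda>x y. (x, y) \<in> parcs T) (t p)"
    and "\<And>p q. (p, q) \<in> parcs T \<Longrightarrow> t q = t p @ [q]"
proof -
  have sub: "subgraph (with_proj T) (with_proj G)" and verts: "pverts G = pverts T"
    and tree: "underlying_tree T" and r: "r \<in> pverts T"
    and unique: "\<And>v. v \<in> pverts T \<Longrightarrow> \<exists>!w. pre_digraph.apath (with_proj T) r w v"
    using assms by (auto simp: rooted_spanning_tree_def spanning_def)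
  have "wf_digraph (with_proj T)"
    using sub by (simp add: subgraph_def)
  then interpret T: pair_wf_digraph T
    by (simp add: wf_digraph_def pair_wf_digraph_def)
  define path where "path v = (THE w. T.apath r w v)" for v
  have path: "T.apath r (path v) v" if "v \<in> pverts T" for v
    unfolding path_def by (rule theI'[OF unique[OF that]])
  have path_eq: "path v = w" if "T.apath r w v" for v w
    using that path[of v] unique[of v] T.awalk_last_in_verts[of r w v]
    by (auto simp: T.apath_def)
  show thesis
  proof (rule that[of "\<lambda>v. pawalk_verts r (path v)"])
    have "T.apath r [] r" using r by (simp add: T.apath_Nil_iff)
    then show "pawalk_verts r (path r) = [r]" using path_eq by simp
  next
    fix p assume "p \<in> pverts G"
    then have walk: "T.awalk r (path p) p" using path verts by (simp add: T.apath_def)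
    have "successively (\<lambda>x y. (x, y) \<in> parcs T) (pawalk_verts r (path p))"
      by (rule successively_mono[OF T.awalk_successively[OF walk]]) auto
    then show "set (pawalk_verts r (path p)) \<subseteq> pverts G \<and> pawalk_verts r (path p) \<noteq> [] \<and>
        hd (pawalk_verts r (path p)) = r \<and> last (pawalk_verts r (path p)) = p \<and>
        successively (\<lambda>x y. (x, y) \<in> parcs T) (pawalk_verts r (path p))"
      using walk verts T.awalk_verts_non_Nil by (auto dest: T.awalk_verts_in_verts)
  next
    fix p q assume pq: "(p, q) \<in> parcs T"
    then have pverts: "p \<in> pverts T" "q \<in> pverts T" by (auto dest: T.in_arcsD1 T.in_arcsD2)
    note p = path[OF pverts(1)]
    have walk: "T.awalk r (path p) p" using p by (simp add: T.apath_def)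
    \<comment> \<open>If \<open>q\<close> lay on the path to \<open>p\<close>, the part after
      \<open>q\<close> would close up with the arc. So adding the arc gives a path again, which must
      be the unique one to \<open>q\<close>.\<close>
    have "q \<notin> set (pawalk_verts r (path p))"
    proof
      assume "q \<in> set (pawalk_verts r (path p))"
      then obtain a b where ab: "path p = a @ b" "T.awalk r a q" "T.awalk q b p"
        using T.awalk_decomp[OF walk] by blast
      then have "T.apath q b p" using p by (simp add: T.apath_append_iff)
      then show False using T.underlying_tree_no_return tree pq by blast
    qed
    moreover have cyc: "T.awalk r (path p @ [(p, q)]) q"
      using walk pq pverts by (auto simp: T.awalk_Cons_iff T.awalk_Nil_iff)
    moreover have verts: "pawalk_verts r (path p @ [(p, q)]) = pawalk_verts r (path p) @ [q]"
      using T.awalk_verts_append[OF cyc] by simp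
    ultimately have "T.apath r (path p @ [(p, q)]) q"
      using p by (simp add: T.apath_def)
    then show "pawalk_verts r (path q) = pawalk_verts r (path p) @ [q]"
      using path_eq verts by simp
  qed
qed

section \<open>Regular \<open>*\<close>-semigroups\<close>

context regular_star_semigroup
begin

lemma proj_simps:
  assumes "p \<in> projections S"
  shows "p \<in> carrier S" "p \<odot> p = p" "star S p = p"
  using assms by (auto simp: projections_def)

lemma proj_absorb:
  assumes "p \<in> projections S" "x \<in> carrier S"
  shows "p \<odot> (p \<odot> x) = p \<odot> x"
  using assms mult_assoc[of p p x] by (simp add: proj_simps)

text \<open>Regularity applied to pq, whose star is qp, gives pq = pq qp pq, and repeated letters
  merge.\<close>

lemma proj_mult_idem:
  assumes "p \<in> projections S" "q \<in> projections S"
  shows "p \<odot> (q \<odot> (p \<odot> q)) = p \<odot> q"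
proof -
  note p = proj_simps[OF assms(1)] and q = proj_simps[OF assms(2)]
  have "p \<odot> q = (p \<odot> q) \<odot> (q \<odot> p) \<odot> (p \<odot> q)"
    using star_regular[of "p \<odot> q"] p q by (simp add: star_mult mult_closed)
  also have "\<dots> = p \<odot> (q \<odot> (q \<odot> (p \<odot> (p \<odot> q))))"
    using p(1) q(1) by (simp only: mult_assoc mult_closed)
  also have "\<dots> = p \<odot> (q \<odot> (p \<odot> q))"
    using p q assms by (simp only: proj_absorb mult_closed)
  finally show ?thesis by simp
qed

text \<open>The form of \<open>proj_mult_idem\<close> that can rewrite inside products nested to the
  right.\<close>

lemma proj_mult_absorb:
  assumes "p \<in> projections S" "q \<in> projections S" "x \<in> carrier S"
  shows "p \<odot> (q \<odot> (p \<odot> (q \<odot> x))) = p \<odot> (q \<odot> x)"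
proof -
  note c = proj_simps(1)[OF assms(1)] proj_simps(1)[OF assms(2)] assms(3)
  have "p \<odot> (q \<odot> (p \<odot> (q \<odot> x))) = (p \<odot> (q \<odot> (p \<odot> q))) \<odot> x"
    using c by (simp only: mult_assoc mult_closed)
  also have "\<dots> = p \<odot> (q \<odot> x)"
    using c proj_mult_idem[OF assms(1,2)] by (simp only: mult_assoc)
  finally show ?thesis .
qed

lemmas proj_rules = proj_simps proj_absorb proj_mult_idem proj_mult_absorb mult_assoc mult_closed

lemma proj_conj:
  assumes "p \<in> projections S" "q \<in> projections S"
  shows "p \<odot> (q \<odot> p) \<in> projections S"
proof -
  have "p \<odot> (q \<odot> p) \<in> carrier S"
    using assms by (simp add: proj_rules)
  moreover have "(p \<odot> (q \<odot> p)) \<odot> (p \<odot> (q \<odot> p)) = p \<odot> (q \<odot> p)"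
    using assms by (simp add: proj_rules)
  moreover have "star S (p \<odot> (q \<odot> p)) = p \<odot> (q \<odot> p)"
    using assms by (simp add: proj_rules star_mult)
  ultimately show ?thesis by (simp add: projections_def)
qed

lemma projection_algebra:
  assumes "is_projection_algebra_of P S"
  shows "projection_algebra P"
proof -
  have P: "carrier P = projections S"
    and act: "\<And>p q. p \<in> projections S \<Longrightarrow> q \<in> projections S \<Longrightarrow> act P p q = p \<odot> (q \<odot> p)"
    using assms by (auto simp: is_projection_algebra_of_def proj_simps mult_assoc)
  show ?thesis
    \<comment> \<open>Each axiom becomes an equation between products nested to the right, which
      \<open>proj_rules\<close> normalises.\<close>
    by (unfold_locales; simp only: P act proj_conj; simp add: proj_rules)
qed

text \<open>The product pq links the two projections: p R pq because pqp = p, and pq L q because qpq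
  = q.\<close>

lemma friendly_green_D:
  assumes P: "is_projection_algebra_of P S" and pq: "(p, q) \<in> friendliness P"
  shows "(p, q) \<in> green_D S"
proof -
  have c: "p \<in> carrier S" "q \<in> carrier S" and conj: "p \<odot> q \<odot> p = p" "q \<odot> p \<odot> q = q"
    using P pq by (auto simp: is_projection_algebra_of_def friendliness_def projections_def)
  note closed = c mult_closed[OF c]
  have "(p, p \<odot> q) \<in> green_R S"
  proof -
    have "p \<odot> x = p \<odot> q \<odot> (p \<odot> x)" "p \<odot> q \<odot> x = p \<odot> (q \<odot> x)" if "x \<in> carrier S" for x
    proof -
      show "p \<odot> x = p \<odot> q \<odot> (p \<odot> x)"
        using mult_assoc[OF closed(3,1) that] conj by simp
      show "p \<odot> q \<odot> x = p \<odot> (q \<odot> x)"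
        by (rule mult_assoc[OF c that])
    qed
    then have "right_ideal S p = right_ideal S (p \<odot> q)"
      using conj mult_closed closed unfolding right_ideal_def by (auto; metis)
    then show ?thesis using closed by (simp add: green_R_def)
  qed
  moreover have "(p \<odot> q, q) \<in> green_L S"
  proof -
    have "x \<odot> q = x \<odot> q \<odot> (p \<odot> q)" "x \<odot> (p \<odot> q) = x \<odot> p \<odot> q" if "x \<in> carrier S" for x
    proof -
      show "x \<odot> q = x \<odot> q \<odot> (p \<odot> q)"
        using mult_assoc[OF that closed(2,3)] mult_assoc[OF closed(2,1,2)] conj by simp
      show "x \<odot> (p \<odot> q) = x \<odot> p \<odot> q"
        by (rule mult_assoc[OF that c, symmetric])
    qed
    moreover have "q = q \<odot> (p \<odot> q)"
      using conj mult_assoc[OF closed(2,1,2)] by simp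
    ultimately have "left_ideal S (p \<odot> q) = left_ideal S q"
      using mult_closed closed unfolding left_ideal_def by (auto; metis)
    then show ?thesis using closed by (simp add: green_L_def)
  qed
  ultimately show ?thesis
    unfolding green_D_def by (meson UnCI r_into_trancl trancl_into_trancl)
qed

end

theorem theorem6p28:
  fixes P :: "'a proj_alg" and S :: "'a star_sgp" and p\<^sub>0 :: 'a
    and P_D :: "'a set" and T :: "'a pair_pre_digraph"
  assumes "regular_star_semigroup S"
    and "projection_generated S"
    and "is_projection_algebra_of P S"
    and "p\<^sub>0 \<in> carrier P"
    and "P_D = carrier P \<inter> green_D S `` {p\<^sub>0}"
    and "rooted_spanning_tree p\<^sub>0 T (friendliness_digraph P P_D)"
  shows "maximal_subgroup (PG P) (PG_gen P p\<^sub>0) \<cong>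
    group_presentation (subgroup_generators P P_D) (subgroup_relations P P_D T)"
proof -
  interpret S: regular_star_semigroup S by (rule assms(1))
  interpret projection_algebra P by (rule S.projection_algebra[OF assms(3)])
  obtain t where root: "t p\<^sub>0 = [p\<^sub>0]"
    and path: "\<And>p. p \<in> P_D \<Longrightarrow> set (t p) \<subseteq> P_D \<and> t p \<noteq> [] \<and> hd (t p) = p\<^sub>0 \<and> last (t p) = p
      \<and> successively (\<lambda>x y. (x, y) \<in> parcs T) (t p)"
    and arc: "\<And>p q. (p, q) \<in> parcs T \<Longrightarrow> t q = t p @ [q]"
    using rooted_spanning_tree_paths[OF assms(6)] by (auto simp: friendliness_digraph_def)
  interpret projection_component P P_D "p\<^sub>0" T t
  proof
    show "P_D \<subseteq> carrier P" using assms(5) by simp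
    \<comment> \<open>As \<open>green_D\<close> is a transitive closure, a friendliness edge can be
      appended to any chain that starts at the root.\<close>
    show "q \<in> P_D" if "p \<in> P_D" "(p, q) \<in> friendliness P" for p q
      using that S.friendly_green_D[OF assms(3) that(2)] friendly_iff
      by (auto simp: assms(5) green_D_def)
    \<comment> \<open>Reflexivity of \<open>green_D\<close> at the root comes from its friendliness
      loop.\<close>
    show "p\<^sub>0 \<in> P_D"
      using S.friendly_green_D[OF assms(3) friendly_refl] assms(4,5) by simp
    show "parcs T \<subseteq> friendliness P \<inter> P_D \<times> P_D"
      using assms(6)
      by (auto simp: rooted_spanning_tree_def spanning_def subgraph_def friendliness_digraph_def)
  qed (use root path arc in auto)
  show ?thesis by (rule maximal_subgroup_iso)
qed

end
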